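(* Let $c\ge 1$ and let $(\mathcal U,F_{\mathcal U})$, $(\mathcal V,F_{\mathcal V})$, $(\mathcal W,F_{\mathcal W})$ be sequences of covers indexed by $\alpha\in[0,\infty)$, with underlying spaces satisfying $U(\alpha)\subseteq V(\alpha)\subseteq W(\alpha)\subseteq U(c\alpha)$ for all $\alpha\ge 0$. Suppose there are maps of covers $F_{\mathcal V,\mathcal W}^{\alpha,\alpha'}:\mathcal V(\alpha)\to\mathcal W(\alpha')$ and $F_{\mathcal W,\mathcal V}^{\alpha,c\alpha'}:\mathcal W(\alpha)\to\mathcal V(c\alpha')$ for all $\alpha'\ge\alpha$, satisfying the coherence relations $$F_{\mathcal W}^{\alpha',\alpha''}\circ F_{\mathcal V,\mathcal W}^{\alpha,\alpha'}=F_{\mathcal V,\mathcal W}^{\alpha',\alpha''}\circ F_{\mathcal V}^{\alpha,\alpha'},\qquad F_{\mathcal W,\mathcal V}^{\alpha/c,c\alpha'}\circ F_{\mathcal V,\mathcal W}^{\alpha/c,\alpha/c}=F_{\mathcal V}^{\alpha/c,c\alpha'}$$ for all $\alpha''\ge\alpha'\ge\alpha$. Assume that every cover $\mathcal U(\alpha)$ and every cover $\mathcal W(\alpha)$ is good. Fix $p\ge 0$ and define, for each $\alpha\ge0$, $$\phi_\alpha=\rho_{\mathcal V(c\alpha)}\circ\big(\mathrm{inc}_{U(\alpha)}^{V(c\alpha)}\big)_*\circ\rho_{\mathcal U(\alpha)}^{-1}:H_p(|N\mathcal U(\alpha)|)\to H_p(|N\mathcal V(c\alpha)|),$$ $$\psi_\alpha=\rho_{\mathcal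 U(c\alpha)}\circ\big(\mathrm{inc}_{W(\alpha)}^{U(c\alpha)}\big)_*\circ\rho_{\mathcal W(\alpha)}^{-1}\circ |F_{\mathcal V,\mathcal W}^{\alpha,\alpha}|_*:H_p(|N\mathcal V(\alpha)|)\to H_p(|N\mathcal U(c\alpha)|).$$ Then the families $\{\phi_\alpha\}_{\alpha\ge0}$ and $\{\psi_\alpha\}_{\alpha\ge0}$ satisfy the four relations in the definition of $c$-approximate persistence modules for the persistence modules $(H_p(|N\mathcal U|),|F_{\mathcal U}|_* )$ and $(H_p(|N\mathcal V|),|F_{\mathcal V}|_* )$; in particular these two persistence modules are $c$-approximate.
   Context: All homology is singular homology with $\mathbb Z_2$ coefficients. A (finite) cover $\mathcal U=\{U_i\mid i\in I\}$ is a finite family of open subsets of a fixed metric space, covering $U=\bigcup_i U_i$. Its nerve $N\mathcal U$ is the simplicial complex on vertex set $I$ with $[i_0,\dots,i_k]$ a simplex iff $U_{i_0}\cap\dots\cap U_{i_k}\neq\emptyset$; $|\cdot|$ denotes geometric realization, and for a simplicial map $f$, $|f|$ is its linear extension. If $\mathcal U$ covers $U$ and $\mathcal V=\{V_j\mid j\in J\}$ covers $V\supseteq U$, a map of covers is a map $F:I\to J$ with $U_i\subseteq V_{F(i)}$ for all $i$; it induces a simplicial map $N\mathcal U\to N\mathcal V$. A sequence of covers $(\mathcal U,F)$ is a family of covers $\mathcal U(\alpha)=\{U_i(\alpha)\mid i\in I(\alpha)\}$ of spaces $U(\alpha)$, $\alpha\ge0$, with maps of covers $F^{\alpha,\alpha'}:I(\alpha)\to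 I(\alpha')$ for $\alpha\le\alpha'$, such that $F^{\alpha,\alpha}=\mathrm{id}$ and $F^{\alpha,\alpha''}=F^{\alpha',\alpha''}\circ F^{\alpha,\alpha'}$. Its associated persistence module is $\alpha\mapsto H_p(|N\mathcal U(\alpha)|)$ with maps $|F^{\alpha,\alpha'}|_*$. A cover is good if every nonempty finite intersection of its sets is contractible. For a cover $\mathcal U$ of $U$, let $\Delta U_{\mathcal U}\subseteq |N\mathcal U|\times U$ be the union over simplices $S\in N\mathcal U$ of $|S|\times\bigcap_{i\in S}U_i$ (faces identified in the evident way), with projections $\pi_1:\Delta U_{\mathcal U}\to|N\mathcal U|$ and $\pi_2:\Delta U_{\mathcal U}\to U$; $\pi_2$ is a homotopy equivalence (standard), and one sets $\rho_{\mathcal U}=(\pi_1)_*\circ(\pi_2)_*^{-1}:H_p(U)\to H_p(|N\mathcal U|)$. If $\mathcal U$ is good, $\rho_{\mathcal U}$ is an isomorphism (nerve theorem). $\mathrm{inc}_A^B$ denotes the inclusion $A\hookrightarrow B$. Two persistence modules $\mathbb U=(U(\alpha),u^{\alpha,\alpha'})$ and $\mathbb V=(V(\alpha),v^{\alpha,\alpha'})$ indexed by $[0,\infty)$ are $c$-approximate ($c\ge1$) via families of linear maps $\phi_\alpha:U(\alpha)\to V(c\alpha)$, $\psi_\alpha:V(\alpha)\to U(c\alpha)$ if for all $\alpha\le\alpha'$: $\psi_{\alpha'}\circ v^{\alpha,\alpha'}\circ\phi_{\alpha/c}=u^{\alpha/c,c\alpha'}$, $\phi_{\alpha'}\circ u^{\alpha,\alpha'}\circ\psi_{\alpha/c}=v^{\alpha/c,c\alpha'}$,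 $\psi_{\alpha'}\circ v^{\alpha,\alpha'}=u^{c\alpha,c\alpha'}\circ\psi_\alpha$, and $\phi_{\alpha'}\circ u^{\alpha,\alpha'}=v^{c\alpha,c\alpha'}\circ\phi_\alpha$; they are $c$-approximate if such families exist. *)

theory Defs
  imports "HOL-Analysis.Analysis" "HOL-Homology.Homology"
begin

text \<open>The singular chain complex with Z/2 coefficients is the integral singular chain
complex reduced modulo 2.  We represent a mod-2 chain by an integral chain; a mod-2
p-cycle is an integral p-chain whose boundary is divisible by 2, and a mod-2 p-boundary
is an integral p-chain of the form (boundary of a (p+1)-chain) + 2 * (a p-chain).\<close>

definition z2_cycle :: "nat \<Rightarrow> 'a topology \<Rightarrow> 'a chain \<Rightarrow> bool" where
  "z2_cycle p X c \<longleftrightarrow> singular_chain p X c \<and>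
     (\<exists>e. singular_chain (p - 1) X e \<and> chain_boundary p c = e + e)"

definition z2_boundary :: "nat \<Rightarrow> 'a topology \<Rightarrow> 'a chain \<Rightarrow> bool" where
  "z2_boundary p X c \<longleftrightarrow>
     (\<exists>d e. singular_chain (Suc p) X d \<and> singular_chain p X e \<and>
            c = chain_boundary (Suc p) d + (e + e))"

definition z2_cycle_group :: "nat \<Rightarrow> 'a topology \<Rightarrow> 'a chain monoid" where
  "z2_cycle_group p X = subgroup_generated (chain_group p X) (Collect (z2_cycle p X))"

text \<open>The p-th singular homology group of X with Z/2 coefficients (a Z/2-vector space,
i.e. an elementary abelian 2-group; Z/2-linear maps are exactly group homomorphisms).\<close>
definition z2_homology :: "nat \<Rightarrow> 'a topology \<Rightarrow> 'a chain set monoid" where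
  "z2_homology p X = z2_cycle_group p X Mod Collect (z2_boundary p X)"

definition z2_induced :: "nat \<Rightarrow> 'a topology \<Rightarrow> 'b topology \<Rightarrow> ('a \<Rightarrow> 'b)
                            \<Rightarrow> 'a chain set \<Rightarrow> 'b chain set" where
  "z2_induced p X Y f C =
     (if C \<in> carrier (z2_homology p X)
      then Collect (z2_boundary p Y) #>\<^bsub>z2_cycle_group p Y\<^esub> chain_map p f (SOME c. c \<in> C)
      else \<one>\<^bsub>z2_homology p Y\<^esub>)"

text \<open>A cover is given by a finite index set I and a family of sets U indexed by I
(only the values on I matter).  It is a cover of its union.\<close>

definition cover_space :: "'i set \<Rightarrow> ('i \<Rightarrow> 'a set) \<Rightarrow> 'a set" where
  "cover_space I U = (\<Union>i\<in>I. U i)"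

definition is_cover :: "'i set \<Rightarrow> ('i \<Rightarrow> 'a::topological_space set) \<Rightarrow> bool" where
  "is_cover I U \<longleftrightarrow> finite I \<and> (\<forall>i\<in>I. open (U i))"

definition map_of_covers :: "'i set \<Rightarrow> ('i \<Rightarrow> 'a set) \<Rightarrow> 'j set \<Rightarrow> ('j \<Rightarrow> 'a set)
                              \<Rightarrow> ('i \<Rightarrow> 'j) \<Rightarrow> bool" where
  "map_of_covers I U J V F \<longleftrightarrow> (\<forall>i\<in>I. F i \<in> J \<and> U i \<subseteq> V (F i))"

definition nerve :: "'i set \<Rightarrow> ('i \<Rightarrow> 'a set) \<Rightarrow> 'i set set" where
  "nerve I U = {S. S \<subseteq> I \<and> S \<noteq> {} \<and> (\<Inter>i\<in>S. U i) \<noteq> {}}"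

text \<open>Geometric realization of a simplicial complex K on a finite vertex set V:
points are barycentric coordinate functions supported on a simplex of K, with the
topology induced from the product topology on 'i \<Rightarrow> real.\<close>
definition realization_set :: "'i set \<Rightarrow> 'i set set \<Rightarrow> ('i \<Rightarrow> real) set" where
  "realization_set V K = {t. (\<forall>i. 0 \<le> t i) \<and> (\<forall>i. i \<notin> V \<longrightarrow> t i = 0) \<and>
                               sum t V = 1 \<and> {i\<in>V. t i \<noteq> 0} \<in> K}"

definition realization :: "'i set \<Rightarrow> 'i set set \<Rightarrow> ('i \<Rightarrow> real) topology" where
  "realization V K = subtopology (powertop_real UNIV) (realization_set V K)"

definition nerve_real :: "'i set \<Rightarrow> ('i \<Rightarrow> 'a set) \<Rightarrow> ('i \<Rightarrow> real) topology" where
  "nerve_real I U = realization I (nerve I U)"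

definition lin_ext :: "'i set \<Rightarrow> ('i \<Rightarrow> 'j) \<Rightarrow> ('i \<Rightarrow> real) \<Rightarrow> ('j \<Rightarrow> real)" where
  "lin_ext I F t = (\<lambda>j. \<Sum>i\<in>{i\<in>I. F i = j}. t i)"

definition delta_set :: "'i set \<Rightarrow> ('i \<Rightarrow> 'a set) \<Rightarrow> (('i \<Rightarrow> real) \<times> 'a) set" where
  "delta_set I U = (\<Union>S\<in>nerve I U. {t\<in>realization_set I (nerve I U). {i\<in>I. t i \<noteq> 0} \<subseteq> S}
                                     \<times> (\<Inter>i\<in>S. U i))"

definition delta_space :: "'i set \<Rightarrow> ('i \<Rightarrow> 'a::topological_space set)
                             \<Rightarrow> (('i \<Rightarrow> real) \<times> 'a) topology" where
  "delta_space I U = subtopology (prod_topology (nerve_real I U) (top_of_set (cover_space I U)))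
                                 (delta_set I U)"

definition rho :: "nat \<Rightarrow> 'i set \<Rightarrow> ('i \<Rightarrow> 'a::topological_space set)
                     \<Rightarrow> 'a chain set \<Rightarrow> ('i \<Rightarrow> real) chain set" where
  "rho p I U = z2_induced p (delta_space I U) (nerve_real I U) fst \<circ>
               inv_into (carrier (z2_homology p (delta_space I U)))
                        (z2_induced p (delta_space I U) (top_of_set (cover_space I U)) snd)"

text \<open>Inverse of rho (meaningful when rho is bijective, e.g. for good covers).\<close>
definition rho_inv :: "nat \<Rightarrow> 'i set \<Rightarrow> ('i \<Rightarrow> 'a::topological_space set)
                         \<Rightarrow> ('i \<Rightarrow> real) chain set \<Rightarrow> 'a chain set" where
  "rho_inv p I U = inv_into (carrier (z2_homology p (top_of_set (cover_space I U)))) (rho p I U)"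

definition good_cover :: "'i set \<Rightarrow> ('i \<Rightarrow> 'a::topological_space set) \<Rightarrow> bool" where
  "good_cover I U \<longleftrightarrow> (\<forall>S. S \<subseteq> I \<longrightarrow> S \<noteq> {} \<longrightarrow> (\<Inter>i\<in>S. U i) \<noteq> {}
                             \<longrightarrow> contractible (\<Inter>i\<in>S. U i))"

definition cover_sequence :: "(real \<Rightarrow> 'i set) \<Rightarrow> (real \<Rightarrow> 'i \<Rightarrow> 'a::topological_space set)
                               \<Rightarrow> (real \<Rightarrow> real \<Rightarrow> 'i \<Rightarrow> 'i) \<Rightarrow> bool" where
  "cover_sequence I U F \<longleftrightarrow>
     (\<forall>a. 0 \<le> a \<longrightarrow> is_cover (I a) (U a)) \<and>
     (\<forall>a a'. 0 \<le> a \<and> a \<le> a' \<longrightarrow> map_of_covers (I a) (U a) (I a') (U a') (F a a')) \<and>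
     (\<forall>a. 0 \<le> a \<longrightarrow> (\<forall>i\<in>I a. F a a i = i)) \<and>
     (\<forall>a a' a''. 0 \<le> a \<and> a \<le> a' \<and> a' \<le> a'' \<longrightarrow>
         (\<forall>i\<in>I a. F a a'' i = F a' a'' (F a a' i)))"

definition c_approximate_via ::
  "real \<Rightarrow> (real \<Rightarrow> 'u monoid) \<Rightarrow> (real \<Rightarrow> real \<Rightarrow> 'u \<Rightarrow> 'u)
        \<Rightarrow> (real \<Rightarrow> 'v monoid) \<Rightarrow> (real \<Rightarrow> real \<Rightarrow> 'v \<Rightarrow> 'v)
        \<Rightarrow> (real \<Rightarrow> 'u \<Rightarrow> 'v) \<Rightarrow> (real \<Rightarrow> 'v \<Rightarrow> 'u) \<Rightarrow> bool" where
  "c_approximate_via c UU u VV v \<phi> \<psi> \<longleftrightarrow>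
     (\<forall>a. 0 \<le> a \<longrightarrow> \<phi> a \<in> hom (UU a) (VV (c * a)) \<and> \<psi> a \<in> hom (VV a) (UU (c * a))) \<and>
     (\<forall>a a'. 0 \<le> a \<and> a \<le> a' \<longrightarrow>
        (\<forall>x\<in>carrier (UU (a / c)). \<psi> a' (v a a' (\<phi> (a / c) x)) = u (a / c) (c * a') x) \<and>
        (\<forall>y\<in>carrier (VV (a / c)). \<phi> a' (u a a' (\<psi> (a / c) y)) = v (a / c) (c * a') y) \<and>
        (\<forall>y\<in>carrier (VV a). \<psi> a' (v a a' y) = u (c * a) (c * a') (\<psi> a y)) \<and>
        (\<forall>x\<in>carrier (UU a). \<phi> a' (u a a' x) = v (c * a) (c * a') (\<phi> a x)))"

definition c_approximate ::
  "real \<Rightarrow> (real \<Rightarrow> 'u monoid) \<Rightarrow> (real \<Rightarrow> real \<Rightarrow> 'u \<Rightarrow> 'u)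
        \<Rightarrow> (real \<Rightarrow> 'v monoid) \<Rightarrow> (real \<Rightarrow> real \<Rightarrow> 'v \<Rightarrow> 'v) \<Rightarrow> bool" where
  "c_approximate c UU u VV v \<longleftrightarrow> (\<exists>\<phi> \<psi>. c_approximate_via c UU u VV v \<phi> \<psi>)"

end

(*
Naturality of rho turns every relation into bookkeeping: for a map of covers F from U to V the
map (t, x) -> (|F| t, x) of the blow-up spaces Delta gives rho_V o inc_* = |F|_* o rho_U, so phi and psi can be
pushed through all transition maps until only inclusions of the underlying spaces remain.

That pi_2 is a homotopy equivalence comes from a partition of unity and straight-line homotopies.
For the nerve theorem, cover |N U| by the open stars of its vertices.  Over an intersection of
stars, i.e. the star of a simplex J, both |N U| and the blow-up contract, the latter because it
deforms onto {barycenter of J} x (intersection of U_i over J).  A Mayer-Vietoris argument for the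
integral mapping cone of pi_1 then shows that the cone is acyclic, and acyclicity passes to the
mod-2 cone.
*)
theory Submission
  imports Defs
begin

text \<open>Acyclicity of a cone states an isomorphism as a vanishing result, so gluing over two
  open sets becomes a single chase: two acyclic pieces and an acyclic overlap replace the comparison
  of two long exact sequences. Since mod-2 chains are represented by integral chains, and
  subdivision and homotopy invariance are available on integral chains, all geometry is done
  integrally and only the finished statement is reduced modulo 2. Both projections of the blow-up
  reach mod-2 homology by this one route.

  The obstacle in the interleaving is that V(\<alpha>) is not assumed good: rho for V need not be
  invertible, and a class of the nerve of V(\<alpha>) need not come from the space V(\<alpha>). This
  is why \<psi> first passes to the good cover W(\<alpha>), and why a map of covers back from W to V
  is called for. Between U and the other two sequences there are only inclusions of spaces, no maps
  of covers, so these comparisons have to take place in the homology of the spaces.\<close>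

section \<open>Mapping cones of singular chain maps\<close>

text \<open>In degree 0 the domain component has degree -1, hence is required to vanish; the truncated
  \<open>p - 1\<close> alone would not express this.\<close>

definition cone_chain :: "nat \<Rightarrow> 'a topology \<Rightarrow> 'b topology \<Rightarrow> 'b chain \<times> 'a chain \<Rightarrow> bool" where
  "cone_chain p X Y z \<longleftrightarrow> singular_chain p Y (fst z) \<and>
     (if p = 0 then snd z = 0 else singular_chain (p - 1) X (snd z))"

text \<open>With this sign a cycle is a pair \<open>(y, x)\<close> in which \<open>x\<close> is a
  cycle and the boundary of \<open>y\<close> is the image of \<open>x\<close>. In degree 0 the
  truncated \<open>p - 1\<close> is harmless, since the second component of a cone chain is 0
  there.\<close>

definition cone_boundary :: "nat \<Rightarrow> ('a \<Rightarrow> 'b) \<Rightarrow> 'b chain \<times> 'a chain \<Rightarrow> 'b chain \<times> 'a chain" where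
  "cone_boundary p f z =
     (chain_boundary p (fst z) - chain_map (p - 1) f (snd z), - chain_boundary (p - 1) (snd z))"

text \<open>By the long exact sequence of the cone this encodes that \<open>f\<close> is an
  isomorphism on integral homology in all degrees. The case \<open>p = 0\<close> is surjectivity on
  degree-0 homology.\<close>

definition cone_acyclic :: "'a topology \<Rightarrow> 'b topology \<Rightarrow> ('a \<Rightarrow> 'b) \<Rightarrow> bool" where
  "cone_acyclic X Y f \<longleftrightarrow>
     (\<forall>p z. cone_chain p X Y z \<and> cone_boundary p f z = 0 \<longrightarrow>
        (\<exists>w. cone_chain (Suc p) X Y w \<and> cone_boundary (Suc p) f w = z))"

lemma cone_chain_add: "cone_chain p X Y z \<Longrightarrow> cone_chain p X Y w \<Longrightarrow> cone_chain p X Y (z + w)"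
  by (auto simp: cone_chain_def singular_chain_add split: if_splits)

lemma cone_chain_diff: "cone_chain p X Y z \<Longrightarrow> cone_chain p X Y w \<Longrightarrow> cone_chain p X Y (z - w)"
  by (auto simp: cone_chain_def singular_chain_diff split: if_splits)

lemma cone_chain_uminus: "cone_chain p X Y z \<Longrightarrow> cone_chain p X Y (- z)"
  by (auto simp: cone_chain_def singular_chain_minus split: if_splits)

lemma cone_boundary_add: "cone_boundary p f (z + w) = cone_boundary p f z + cone_boundary p f w"
  by (simp add: cone_boundary_def chain_boundary_add chain_map_add prod_eq_iff)

lemma cone_boundary_diff: "cone_boundary p f (z - w) = cone_boundary p f z - cone_boundary p f w"
  by (simp add: cone_boundary_def chain_boundary_diff chain_map_diff prod_eq_iff)

lemma cone_chain_cone_boundary: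
  assumes "continuous_map X Y f" "cone_chain (Suc p) X Y z"
  shows "cone_chain p X Y (cone_boundary (Suc p) f z)"
proof -
  have "singular_chain p X (snd z)" "singular_chain (Suc p) Y (fst z)"
    using assms by (auto simp: cone_chain_def)
  then show ?thesis
    using assms singular_chain_boundary[of p X "snd z"]
    by (auto simp: cone_chain_def cone_boundary_def singular_chain_minus singular_chain_boundary_alt
        chain_boundary_def[of 0] intro!: singular_chain_diff singular_chain_chain_map)
qed

lemma cone_boundary_cone_boundary:
  assumes "continuous_map X Y f" "cone_chain (Suc p) X Y z"
  shows "cone_boundary p f (cone_boundary (Suc p) f z) = 0"
proof -
  have "singular_chain p X (snd z)" "singular_chain (Suc p) Y (fst z)"
    using assms by (auto simp: cone_chain_def)
  then show ?thesis
    by (auto simp: cone_boundary_def chain_boundary_diff chain_boundary_minus chain_map_minus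
        chain_boundary_chain_map chain_boundary_boundary chain_boundary_boundary_alt zero_prod_def)
qed

section \<open>Mayer-Vietoris for mapping cones\<close>

lemma singular_chain_subtopology_Int:
  "singular_chain p (subtopology X S) c \<Longrightarrow> singular_chain p (subtopology X T) c \<Longrightarrow>
   singular_chain p (subtopology X (S \<inter> T)) c"
  by (auto simp: singular_chain_subtopology)

text \<open>This is excision inside the subspace \<open>A \<union> B\<close>: the excised set
  \<open>B - A\<close> is closed there and contained in the open set \<open>B\<close>, and what
  remains after removing it is \<open>A\<close>.\<close>

lemma singular_chain_subtopology_Un_split:
  assumes A: "openin X A" and B: "openin X B" and c: "singular_chain p (subtopology X (A \<union> B)) c"
  obtains n d e where "singular_chain p (subtopology X A) d" "singular_chain p (subtopology X B) e"
    "(singular_subdivision p ^^ n) c = d + e"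
proof -
  let ?X = "subtopology X (A \<union> B)"
  have "openin ?X A" and oB: "openin ?X B"
    using A B by (auto simp: openin_subtopology)
  moreover have "topspace ?X - A = B - A"
    using A B openin_subset by fastforce
  ultimately have "closedin ?X (B - A)"
    by (metis closedin_diff closedin_topspace)
  then have "?X closure_of (B - A) \<subseteq> ?X interior_of B"
    using oB by (simp add: closure_of_closedin interior_of_openin)
  moreover have "singular_chain p (subtopology ?X (A \<union> B)) c"
    using c by (simp add: subtopology_subtopology)
  ultimately obtain n d e where nde: "singular_chain p (subtopology ?X ((A \<union> B) - (B - A))) d"
    "singular_chain p (subtopology ?X B) e" "(singular_subdivision p ^^ n) c = d + e"
    using excised_chain_exists[of ?X "B - A" B "A \<union> B" p c] Un_upper2 by metis
  have "(A \<union> B) \<inter> ((A \<union> B) - (B - A)) = A" "(A \<union> B) \<inter> B = B" by auto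
  then show thesis
    using that nde by (simp add: subtopology_subtopology)
qed

text \<open>Subdividing first the domain component and then the corrected codomain component avoids
  any appeal to the naturality of the subdivision homotopy.\<close>

lemma cone_cycle_split:
  assumes f: "continuous_map X Y f" and A: "openin Y A" and B: "openin Y B"
    and z: "cone_chain p (subtopology X (f -` (A \<union> B))) (subtopology Y (A \<union> B)) z"
    and cyc: "cone_boundary p f z = 0"
  obtains w z1 z2 where
    "cone_chain (Suc p) (subtopology X (f -` (A \<union> B))) (subtopology Y (A \<union> B)) w"
    "cone_chain p (subtopology X (f -` A)) (subtopology Y A) z1"
    "cone_chain p (subtopology X (f -` B)) (subtopology Y B) z2"
    "z + cone_boundary (Suc p) f w = z1 + z2"
proof -
  have fr: "continuous_map (subtopology X (f -` C)) (subtopology Y C) f" for C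
    using f by (auto simp: continuous_map_in_subtopology continuous_map_from_subtopology)
  let ?XAB = "subtopology X (f -` (A \<union> B))" and ?YAB = "subtopology Y (A \<union> B)"
  let ?XA = "subtopology X (f -` A)" and ?YA = "subtopology Y A"
  let ?XB = "subtopology X (f -` B)" and ?YB = "subtopology Y B"
  define y where "y = fst z"
  define x where "x = snd z"
  define q where "q = p - 1"
  have y: "singular_chain p ?YAB y" and dy: "chain_boundary p y = chain_map q f x"
    and dx: "chain_boundary q x = 0" and x0: "p = 0 \<Longrightarrow> x = 0"
    and x: "p > 0 \<Longrightarrow> singular_chain q ?XAB x"
    using z cyc by (auto simp: cone_chain_def cone_boundary_def y_def x_def q_def zero_prod_def)
  \<comment> \<open>\<open>u\<close> is the subdivision homotopy applied to \<open>x\<close>. As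
    \<open>x\<close> is a cycle, the boundary of \<open>u\<close> is exactly the difference between
    the subdivided \<open>x\<close> and \<open>x\<close> itself.\<close>
  have "\<exists>u x1 x2. singular_chain p ?XAB u \<and> x + chain_boundary p u = x1 + x2 \<and>
      (if p = 0 then x1 = 0 else singular_chain q ?XA x1) \<and>
      (if p = 0 then x2 = 0 else singular_chain q ?XB x2)"
  proof (cases "p = 0")
    case True
    then show ?thesis using x0 by (intro exI[of _ 0]) auto
  next
    case False
    then have p: "p = Suc q" by (simp add: q_def)
    \<comment> \<open>A preimage under \<open>f\<close> may leave \<open>topspace X\<close>. Cutting
      it down to \<open>topspace X\<close> keeps the subtopology and makes the preimages of
      \<open>A\<close> and \<open>B\<close> open in \<open>X\<close>.\<close>
    have sub: "subtopology X (f -` C) = subtopology X {x \<in> topspace X. f x \<in> C}" for C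
    proof -
      have "topspace X \<inter> f -` C = {x \<in> topspace X. f x \<in> C}" by auto
      then show ?thesis using subtopology_restrict[of X "f -` C"] by simp
    qed
    have "openin X {x \<in> topspace X. f x \<in> A}" "openin X {x \<in> topspace X. f x \<in> B}"
      using f A B by (simp_all add: openin_continuous_map_preimage)
    moreover have "singular_chain q (subtopology X ({x \<in> topspace X. f x \<in> A} \<union> {x \<in> topspace X. f x \<in> B})) x"
      using x False unfolding sub by (simp add: Collect_disj_eq[symmetric] conj_disj_distribL[symmetric])
    ultimately obtain n x1 x2 where n: "singular_chain q ?XA x1" "singular_chain q ?XB x2"
      "(singular_subdivision q ^^ n) x = x1 + x2"
      unfolding sub by (rule singular_chain_subtopology_Un_split)
    obtain h where h: "\<And>p. h p 0 = (0 :: 'a chain)"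
      "\<And>p X c. singular_chain p X c \<Longrightarrow> singular_chain (Suc p) X (h p c)"
      "\<And>p X c. singular_chain p X c \<Longrightarrow>
         chain_boundary (Suc p) (h p c) + h (p - Suc 0) (chain_boundary p c)
           = (singular_subdivision p ^^ n) c - c"
      by (rule chain_homotopic_iterated_singular_subdivision[where n = n]) blast
    have "x + chain_boundary p (h q x) = x1 + x2"
      using h(3)[of q ?XAB x] x False n(3) by (simp add: dx h(1) p)
    then show ?thesis
      using h(2)[of q ?XAB x] x False n p by (intro exI[of _ "h q x"] exI[of _ x1] exI[of _ x2]) auto
  qed
  then obtain u x1 x2 where u: "singular_chain p ?XAB u" and xu: "x + chain_boundary p u = x1 + x2"
    and x1: "if p = 0 then x1 = 0 else singular_chain q ?XA x1"
    and x2: "if p = 0 then x2 = 0 else singular_chain q ?XB x2" by blast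
  \<comment> \<open>Adding the cone boundary of \<open>(0, - u)\<close> turns \<open>x\<close> into
    \<open>x1 + x2\<close> and \<open>y\<close> into \<open>y'\<close>; the boundary of
    \<open>y'\<close> is therefore already split.\<close>
  define y' where "y' = y + chain_map p f u"
  have y': "singular_chain p ?YAB y'"
    unfolding y'_def by (intro singular_chain_add y singular_chain_chain_map[OF u fr])
  have dy': "chain_boundary p y' = chain_map q f x1 + chain_map q f x2"
  proof -
    have "chain_boundary p y' = chain_map q f (x + chain_boundary p u)"
      using chain_boundary_chain_map[OF u, of f] dy
      by (simp add: y'_def q_def chain_boundary_add chain_map_add)
    then show ?thesis by (simp add: xu chain_map_add)
  qed
  obtain n y1 y2 where n: "singular_chain p ?YA y1" "singular_chain p ?YB y2"
    "(singular_subdivision p ^^ n) y' = y1 + y2"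
    by (rule singular_chain_subtopology_Un_split[OF A B y'])
  obtain h where h0: "\<And>p. h p 0 = (0 :: 'b chain)"
    and hdiff: "\<And>p c1 c2. h p (c1 - c2) = h p c1 - h p c2"
    and h: "\<And>p X c. singular_chain p X c \<Longrightarrow> singular_chain (Suc p) X (h p c)"
      "\<And>p X c. singular_chain p X c \<Longrightarrow>
         chain_boundary (Suc p) (h p c) + h (p - Suc 0) (chain_boundary p c)
           = (singular_subdivision p ^^ n) c - c"
    by (rule chain_homotopic_iterated_singular_subdivision[where n = n]) blast
  have hadd: "h p (c1 + c2) = h p c1 + h p c2" for p c1 c2
    by (metis h0 hdiff diff_0 diff_minus_eq_add)
  \<comment> \<open>Subdividing \<open>y'\<close> costs the homotopy applied to its boundary, that
    is to the images of \<open>x1\<close> and \<open>x2\<close>. The homotopy preserves subspaces,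
    so each of the two correction terms can be charged to its own piece.\<close>
  define z1 where "z1 = (y1 - h q (chain_map q f x1), x1)"
  define z2 where "z2 = (y2 - h q (chain_map q f x2), x2)"
  \<comment> \<open>For \<open>p = 0\<close> the truncated \<open>q\<close> has the wrong degree,
    and the claim holds only because \<open>v = 0\<close> and the homotopy sends 0 to 0.\<close>
  have hq: "singular_chain p (subtopology Y C) (h q (chain_map q f v))"
    if "if p = 0 then v = 0 else singular_chain q (subtopology X (f -` C)) v" for C v
  proof (cases "p = 0")
    case True
    then show ?thesis using that by (simp add: h0)
  next
    case False
    then have "singular_chain (Suc q) (subtopology Y C) (h q (chain_map q f v))"
      using that fr by (intro h(1) singular_chain_chain_map) auto
    then show ?thesis using False by (simp add: q_def)
  qed
  have "y' + chain_boundary (Suc p) (h p y') = (y1 - h q (chain_map q f x1)) + (y2 - h q (chain_map q f x2))"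
    using h(2)[OF y'] by (simp add: n(3) dy' hadd q_def algebra_simps)
  then have "z + cone_boundary (Suc p) f (h p y', - u) = z1 + z2"
    using xu unfolding cone_boundary_def z1_def z2_def
    by (simp add: prod_eq_iff chain_map_minus chain_boundary_minus y'_def flip: x_def y_def) (simp add: algebra_simps)
  moreover have "cone_chain (Suc p) ?XAB ?YAB (h p y', - u)"
    using u h(1)[OF y'] by (simp add: cone_chain_def singular_chain_minus)
  moreover have "cone_chain p ?XA ?YA z1" "cone_chain p ?XB ?YB z2"
    using x1 x2 n(1,2) hq[OF x1] hq[OF x2]
    by (auto simp: cone_chain_def z1_def z2_def q_def intro!: singular_chain_diff)
  ultimately show thesis using that by blast
qed

text \<open>Up to a boundary a cycle is \<open>z1 + z2\<close> with parts over \<open>A\<close> and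
  \<open>B\<close>. Their boundaries cancel, so they live over the overlap and are the boundary of
  some \<open>v\<close> there; then \<open>z1 - v\<close> and \<open>z2 + v\<close> are cycles over
  the two pieces and can be filled separately.\<close>

lemma cone_acyclic_Un:
  assumes f: "continuous_map X Y f" and A: "openin Y A" and B: "openin Y B"
    and acA: "cone_acyclic (subtopology X (f -` A)) (subtopology Y A) f"
    and acB: "cone_acyclic (subtopology X (f -` B)) (subtopology Y B) f"
    and acAB: "cone_acyclic (subtopology X (f -` (A \<inter> B))) (subtopology Y (A \<inter> B)) f"
  shows "cone_acyclic (subtopology X (f -` (A \<union> B))) (subtopology Y (A \<union> B)) f"
proof -
  have fr: "continuous_map (subtopology X (f -` C)) (subtopology Y C) f" for C
    using f by (auto simp: continuous_map_in_subtopology continuous_map_from_subtopology)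
  define C where "C = (\<lambda>p A z. cone_chain p (subtopology X (f -` A)) (subtopology Y A) z)"
  have mono: "C p S z \<Longrightarrow> S \<subseteq> T \<Longrightarrow> C p T z" for p S T z
    by (auto simp: C_def cone_chain_def elim: singular_chain_mono dest: vimage_mono[of S T f] split: if_splits)
  have int: "C p S z \<Longrightarrow> C p T z \<Longrightarrow> C p (S \<inter> T) z" for p S T z
    by (auto simp: C_def cone_chain_def vimage_Int intro: singular_chain_subtopology_Int split: if_splits)
  have ac: "\<exists>w. C (Suc p) S w \<and> cone_boundary (Suc p) f w = z"
    if "S \<in> {A, B, A \<inter> B}" "C p S z" "cone_boundary p f z = 0" for p S z
    using that acA acB acAB unfolding cone_acyclic_def C_def by blast
  have "\<exists>w. C (Suc p) (A \<union> B) w \<and> cone_boundary (Suc p) f w = z"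
    if Cz: "C p (A \<union> B) z" and cyc: "cone_boundary p f z = 0" for p z
  proof -
    obtain w z1 z2 where w: "C (Suc p) (A \<union> B) w" and z1: "C p A z1" and z2: "C p B z2"
      and eq: "z + cone_boundary (Suc p) f w = z1 + z2"
      using cone_cycle_split[OF f A B Cz[unfolded C_def] cyc] unfolding C_def by blast
    have "cone_boundary p f (z1 + z2) = 0"
      using cone_boundary_cone_boundary[OF fr w[unfolded C_def]] cyc
      by (simp add: cone_boundary_add flip: eq)
    then have d12: "cone_boundary p f z1 = - cone_boundary p f z2"
      by (simp add: cone_boundary_add eq_neg_iff_add_eq_0)
    \<comment> \<open>The boundary of \<open>z1\<close> is a chain over \<open>A\<close> and, being
      minus the boundary of \<open>z2\<close>, also over \<open>B\<close>. It is thus a cycle over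
      the overlap, one degree lower. In degree 0 there is no lower degree, but the boundary is 0 and
      \<open>v = 0\<close> serves.\<close>
    have "\<exists>v. C p (A \<inter> B) v \<and> cone_boundary p f v = cone_boundary p f z1"
    proof (cases p)
      case 0
      then have "cone_boundary p f z1 = 0"
        using z1 by (simp add: C_def cone_chain_def cone_boundary_def chain_boundary_def zero_prod_def)
      moreover have "C p (A \<inter> B) 0" "cone_boundary p f 0 = 0"
        by (auto simp: C_def cone_chain_def cone_boundary_def zero_prod_def)
      ultimately show ?thesis by metis
    next
      case (Suc q)
      have "C q A (cone_boundary p f z1)"
        using z1 Suc cone_chain_cone_boundary[OF fr] by (simp add: C_def)
      moreover have "C q B (cone_boundary p f z1)"
        unfolding d12 using z2 Suc cone_chain_cone_boundary[OF fr] by (simp add: C_def cone_chain_uminus)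
      ultimately show ?thesis
        using ac[of "A \<inter> B" q "cone_boundary p f z1"] int
          cone_boundary_cone_boundary[OF fr[of A]] z1 Suc by (auto simp: C_def)
    qed
    then obtain v where v: "C p (A \<inter> B) v" and dv: "cone_boundary p f v = cone_boundary p f z1"
      by blast
    have "C p A (z1 - v)" "C p B (z2 + v)"
      using z1 z2 mono[OF v, of A] mono[OF v, of B]
      by (auto simp: C_def intro: cone_chain_diff cone_chain_add)
    then obtain a b where a: "C (Suc p) A a" and b: "C (Suc p) B b"
      and ab: "cone_boundary (Suc p) f a = z1 - v" "cone_boundary (Suc p) f b = z2 + v"
      using ac[of A p "z1 - v"] ac[of B p "z2 + v"]
      by (auto simp: cone_boundary_add cone_boundary_diff dv d12)
    have "C (Suc p) (A \<union> B) (a + b - w)"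
      using w mono[OF a Un_upper1] mono[OF b Un_upper2] unfolding C_def
      by (intro cone_chain_diff cone_chain_add)
    moreover have "cone_boundary (Suc p) f (a + b - w) = z"
      using eq by (simp add: cone_boundary_add cone_boundary_diff ab algebra_simps)
    ultimately show ?thesis by blast
  qed
  then show ?thesis unfolding cone_acyclic_def C_def by blast
qed

lemma cone_acyclic_empty:
  assumes "topspace Y = {}" "topspace X = {}"
  shows "cone_acyclic X Y f"
  by (auto simp: cone_acyclic_def cone_chain_def singular_chain_empty assms cone_boundary_def prod_eq_iff
      split: if_splits)

text \<open>After one member \<open>A\<close> is split off, its overlap with the rest is the union
  of the sets \<open>A \<inter> B\<close>. These form a different family in \<open>\<A>\<close>, not
  a subfamily, but one with fewer members than \<open>\<F>\<close>; hence the induction on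
  cardinality.\<close>

lemma cone_acyclic_Union:
  assumes f: "continuous_map X Y f"
    and op: "\<And>A. A \<in> \<A> \<Longrightarrow> openin Y A"
    and int: "\<And>A B. A \<in> \<A> \<Longrightarrow> B \<in> \<A> \<Longrightarrow> A \<inter> B \<in> \<A>"
    and ac: "\<And>A. A \<in> \<A> \<Longrightarrow> cone_acyclic (subtopology X (f -` A)) (subtopology Y A) f"
    and "finite \<F>" "\<F> \<subseteq> \<A>"
  shows "cone_acyclic (subtopology X (f -` \<Union>\<F>)) (subtopology Y (\<Union>\<F>)) f"
  using \<open>finite \<F>\<close> \<open>\<F> \<subseteq> \<A>\<close>
proof (induction "card \<F>" arbitrary: \<F> rule: less_induct)
  case less
  show ?case
  proof (cases "\<F> = {}")
    case True
    then show ?thesis by (simp add: cone_acyclic_empty)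
  next
    case False
    then obtain A where A: "A \<in> \<F>" by blast
    define \<G> where "\<G> = \<F> - {A}"
    have G: "finite \<G>" "card \<G> < card \<F>" "\<G> \<subseteq> \<A>" "\<Union>\<F> = A \<union> \<Union>\<G>" "A \<in> \<A>"
      using A less.prems card_Diff1_less[of \<F> A] by (auto simp: \<G>_def)
    have H: "A \<inter> \<Union>\<G> = \<Union>((\<inter>) A ` \<G>)" "(\<inter>) A ` \<G> \<subseteq> \<A>" "finite ((\<inter>) A ` \<G>)"
      "card ((\<inter>) A ` \<G>) < card \<F>"
      using G int card_image_le[OF G(1), of "(\<inter>) A"] by auto
    show ?thesis
      unfolding G(4)
    proof (rule cone_acyclic_Un[OF f])
      show "openin Y (\<Union>\<G>)" using op G by blast
      show "cone_acyclic (subtopology X (f -` \<Union>\<G>)) (subtopology Y (\<Union>\<G>)) f"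
        using less.hyps G by blast
      show "cone_acyclic (subtopology X (f -` (A \<inter> \<Union>\<G>))) (subtopology Y (A \<inter> \<Union>\<G>)) f"
        unfolding H(1) using less.hyps H by blast
    qed (use G op ac in auto)
  qed
qed

text \<open>A cone cycle is filled in two stages: injectivity of \<open>f\<close> on homology
  removes the component in \<open>X\<close>, and surjectivity then removes the remaining cycle in
  \<open>Y\<close>.\<close>

lemma cone_acyclic_homotopy_equivalence:
  assumes f: "continuous_map X Y f" and g: "continuous_map Y X g"
    and gf: "homotopic_with (\<lambda>x. True) X X (g \<circ> f) id"
    and fg: "homotopic_with (\<lambda>x. True) Y Y (f \<circ> g) id"
  shows "cone_acyclic X Y f"
  unfolding cone_acyclic_def
proof (intro allI impI, elim conjE)
  have hX: "\<exists>d. singular_chain (Suc p) X d \<and> chain_boundary (Suc p) d = chain_map p g (chain_map p f c) - c"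
    if "singular_chain p X c" "chain_boundary p c = 0" for p c
  proof -
    have "homologous_rel p X {} (chain_map p (g \<circ> f) c) (chain_map p id c)"
      by (rule homotopic_imp_homologous_rel_chain_maps[where T = "{}"])
        (use gf that in \<open>auto simp: singular_cycle\<close>)
    then show ?thesis
      using that by (simp add: homologous_rel_def singular_boundary chain_map_ident chain_map_compose)
  qed
  have hY: "\<exists>d. singular_chain (Suc p) Y d \<and> chain_boundary (Suc p) d = chain_map p f (chain_map p g c) - c"
    if "singular_chain p Y c" "chain_boundary p c = 0" for p c
  proof -
    have "homologous_rel p Y {} (chain_map p (f \<circ> g) c) (chain_map p id c)"
      by (rule homotopic_imp_homologous_rel_chain_maps[where T = "{}"])
        (use fg that in \<open>auto simp: singular_cycle\<close>)
    then show ?thesis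
      using that by (simp add: homologous_rel_def singular_boundary chain_map_ident chain_map_compose)
  qed
  fix p and z :: "'b chain \<times> 'a chain"
  assume z: "cone_chain p X Y z" and cyc: "cone_boundary p f z = 0"
  define y x where "y = fst z" and "x = snd z"
  have y: "singular_chain p Y y" and dy: "chain_boundary p y = chain_map (p - 1) f x"
    and dx: "chain_boundary (p - 1) x = 0"
    using z cyc by (auto simp: cone_chain_def cone_boundary_def y_def x_def zero_prod_def)
  \<comment> \<open>Applying \<open>g\<close> to the relation for the boundary of \<open>y\<close>
    shows that \<open>g (f x)\<close> bounds; it differs from \<open>x\<close> by a boundary because
    \<open>g \<circ> f\<close> is homotopic to the identity.\<close>
  have "\<exists>x1. singular_chain p X x1 \<and> - chain_boundary p x1 = x"
  proof (cases p)
    case 0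
    then show ?thesis using z by (auto simp: cone_chain_def x_def intro!: exI[of _ 0])
  next
    case (Suc q)
    then have "singular_chain q X x" using z by (simp add: cone_chain_def x_def)
    then obtain d where d: "singular_chain p X d" "chain_boundary p d = chain_map q g (chain_map q f x) - x"
      using hX[of q x] dx Suc by auto
    have "chain_map q g (chain_map q f x) = chain_boundary p (chain_map p g y)"
      using chain_boundary_chain_map[OF y, of g] dy Suc by simp
    then have "- chain_boundary p (d - chain_map p g y) = x"
      using d by (simp add: chain_boundary_diff)
    then show ?thesis
      using d y g by (blast intro: singular_chain_diff singular_chain_chain_map)
  qed
  then obtain x1 where x1: "singular_chain p X x1" "- chain_boundary p x1 = x" by blast
  define y1 where "y1 = y + chain_map p f x1"
  have y1: "singular_chain p Y y1"
    unfolding y1_def using y x1 f by (blast intro: singular_chain_add singular_chain_chain_map)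
  moreover have "chain_boundary p y1 = 0"
    using chain_boundary_chain_map[OF x1(1), of f] dy x1(2)[symmetric]
    by (simp add: y1_def chain_boundary_add chain_map_minus)
  ultimately obtain d where d: "singular_chain (Suc p) Y d"
    "chain_boundary (Suc p) d = chain_map p f (chain_map p g y1) - y1" using hY by blast
  have dg: "chain_boundary p (chain_map p g y1) = 0"
    using chain_boundary_chain_map[OF y1, of g] \<open>chain_boundary p y1 = 0\<close> by simp
  \<comment> \<open>In the first component of the cone boundary, \<open>- d\<close> contributes
    \<open>y1\<close> minus the image of \<open>y1\<close> under \<open>f \<circ> g\<close>. The
    term from \<open>chain_map p g y1\<close> cancels that image, and \<open>x1\<close> takes
    \<open>y1\<close> back to \<open>y\<close>.\<close>
  define w where "w = (- d, x1 - chain_map p g y1)"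
  have "cone_chain (Suc p) X Y w"
    using d x1 y1 g by (auto simp: w_def cone_chain_def singular_chain_minus
        intro!: singular_chain_diff singular_chain_chain_map)
  moreover have "cone_boundary (Suc p) f w = z"
    using x1(2) d(2) dg by (simp add: w_def cone_boundary_def prod_eq_iff chain_boundary_minus
        chain_boundary_diff chain_map_diff y1_def x_def y_def)
  ultimately show "\<exists>w. cone_chain (Suc p) X Y w \<and> cone_boundary (Suc p) f w = z" by blast
qed

text \<open>Any constant map back is a homotopy inverse, since all maps into a contractible space
  are homotopic; the point of \<open>X\<close> is its value.\<close>

lemma cone_acyclic_contractible:
  assumes f: "continuous_map X Y f" and X: "contractible_space X" and Y: "contractible_space Y"
    and ne: "topspace X \<noteq> {}"
  shows "cone_acyclic X Y f"
proof -
  obtain a where a: "a \<in> topspace X" using ne by blast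
  show ?thesis
  proof (rule cone_acyclic_homotopy_equivalence[OF f])
    show g: "continuous_map Y X (\<lambda>_. a)" using a by simp
    show "homotopic_with (\<lambda>x. True) X X ((\<lambda>_. a) \<circ> f) id"
      using X continuous_map_compose[OF f g]
      by (intro homotopic_into_contractible_space) auto
    show "homotopic_with (\<lambda>x. True) Y Y (f \<circ> (\<lambda>_. a)) id"
      using Y continuous_map_compose[OF g f]
      by (intro homotopic_into_contractible_space) auto
  qed
qed

section \<open>Homology with coefficients in the field with two elements\<close>

lemma z2_cycle_0: "z2_cycle p X 0"
  unfolding z2_cycle_def by (metis add.right_neutral chain_boundary_0 singular_chain_0)

lemma z2_cycle_diff:
  assumes "z2_cycle p X c" "z2_cycle p X d"
  shows "z2_cycle p X (c - d)"
proof -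
  obtain e e' where "singular_chain (p - 1) X e" "chain_boundary p c = e + e"
    "singular_chain (p - 1) X e'" "chain_boundary p d = e' + e'"
    using assms unfolding z2_cycle_def by blast
  then have "singular_chain (p - 1) X (e - e')" "chain_boundary p (c - d) = (e - e') + (e - e')"
    by (simp_all add: singular_chain_diff chain_boundary_diff)
  then show ?thesis using assms singular_chain_diff unfolding z2_cycle_def by blast
qed

lemma z2_cycle_uminus: "z2_cycle p X c \<Longrightarrow> z2_cycle p X (- c)"
  using z2_cycle_diff[OF z2_cycle_0] by fastforce

lemma z2_cycle_add: "z2_cycle p X c \<Longrightarrow> z2_cycle p X d \<Longrightarrow> z2_cycle p X (c + d)"
  using z2_cycle_diff[OF _ z2_cycle_uminus] by fastforce

lemma z2_boundary_0: "z2_boundary p X 0"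
  unfolding z2_boundary_def by (metis add.right_neutral chain_boundary_0 singular_chain_0)

lemma z2_boundary_diff:
  assumes "z2_boundary p X c" "z2_boundary p X c'"
  shows "z2_boundary p X (c - c')"
proof -
  obtain d e d' e' where de: "singular_chain (Suc p) X d" "singular_chain p X e"
    "c = chain_boundary (Suc p) d + (e + e)" "singular_chain (Suc p) X d'" "singular_chain p X e'"
    "c' = chain_boundary (Suc p) d' + (e' + e')"
    using assms unfolding z2_boundary_def by blast
  then have "c - c' = chain_boundary (Suc p) (d - d') + ((e - e') + (e - e'))"
    by (simp add: chain_boundary_diff)
  then show ?thesis using de singular_chain_diff unfolding z2_boundary_def by blast
qed

lemma z2_boundary_uminus: "z2_boundary p X c \<Longrightarrow> z2_boundary p X (- c)"
  using z2_boundary_diff[OF z2_boundary_0] by fastforce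

lemma z2_boundary_add: "z2_boundary p X c \<Longrightarrow> z2_boundary p X d \<Longrightarrow> z2_boundary p X (c + d)"
  using z2_boundary_diff[OF _ z2_boundary_uminus] by fastforce

lemma z2_boundary_imp_cycle:
  assumes "z2_boundary p X c" shows "z2_cycle p X c"
proof -
  obtain d e where de: "singular_chain (Suc p) X d" "singular_chain p X e"
    "c = chain_boundary (Suc p) d + (e + e)"
    using assms unfolding z2_boundary_def by blast
  then have "chain_boundary p c = chain_boundary p e + chain_boundary p e"
    by (simp add: chain_boundary_add chain_boundary_boundary_alt)
  then show ?thesis
    unfolding z2_cycle_def using de singular_chain_boundary[OF de(2)]
    by (auto intro!: singular_chain_add singular_chain_boundary_alt)
qed

lemma subgroup_z2_cycle: "subgroup (Collect (z2_cycle p X)) (chain_group p X)"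
proof
  show "inv\<^bsub>chain_group p X\<^esub> c \<in> Collect (z2_cycle p X)" if "c \<in> Collect (z2_cycle p X)" for c
  proof -
    have "Poly_Mapping.keys c \<subseteq> singular_simplex_set p X"
      using that by (simp add: z2_cycle_def singular_chain_def)
    then show ?thesis using that by (simp add: z2_cycle_uminus)
  qed
  show "Collect (z2_cycle p X) \<subseteq> carrier (chain_group p X)"
    by (auto simp: z2_cycle_def)
qed (simp_all add: z2_cycle_0 z2_cycle_add)

lemma carrier_z2_cycle_group [simp]: "carrier (z2_cycle_group p X) = Collect (z2_cycle p X)"
  unfolding z2_cycle_group_def
  by (rule subgroup.carrier_subgroup_generated_subgroup[OF subgroup_z2_cycle])

lemma mult_z2_cycle_group [simp]: "(\<otimes>\<^bsub>z2_cycle_group p X\<^esub>) = (+)"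
  by (simp add: z2_cycle_group_def)

lemma one_z2_cycle_group [simp]: "\<one>\<^bsub>z2_cycle_group p X\<^esub> = 0"
  by (simp add: z2_cycle_group_def)

lemma comm_group_z2_cycle_group: "comm_group (z2_cycle_group p X)"
  unfolding z2_cycle_group_def
  by (intro group.abelian_subgroup_generated group_chain_group abelian_chain_group)

lemma group_z2_cycle_group: "group (z2_cycle_group p X)"
  by (simp add: comm_group.axioms(2) comm_group_z2_cycle_group)

lemma inv_z2_cycle_group: "z2_cycle p X c \<Longrightarrow> inv\<^bsub>z2_cycle_group p X\<^esub> c = - c"
  by (intro group.inv_equality group_z2_cycle_group) (auto simp: z2_cycle_uminus)

lemma normal_z2_boundary: "Collect (z2_boundary p X) \<lhd> z2_cycle_group p X"
proof (rule comm_group.subgroup_imp_normal[OF comm_group_z2_cycle_group])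
  show "subgroup (Collect (z2_boundary p X)) (z2_cycle_group p X)"
  proof
    show "inv\<^bsub>z2_cycle_group p X\<^esub> c \<in> Collect (z2_boundary p X)"
      if "c \<in> Collect (z2_boundary p X)" for c
      using that by (simp add: inv_z2_cycle_group z2_boundary_imp_cycle z2_boundary_uminus)
    show "Collect (z2_boundary p X) \<subseteq> carrier (z2_cycle_group p X)"
      by (auto simp: z2_boundary_imp_cycle)
  qed (simp_all add: z2_boundary_0 z2_boundary_add)
qed

section \<open>Classes of mod-2 cycles and induced maps\<close>

definition z2_class :: "nat \<Rightarrow> 'a topology \<Rightarrow> 'a chain \<Rightarrow> 'a chain set" where
  "z2_class p X c = Collect (z2_boundary p X) #>\<^bsub>z2_cycle_group p X\<^esub> c"

lemma z2_class_eq: "z2_class p X c = {b. z2_boundary p X (b - c)}"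
proof -
  have "z2_boundary p X (b - c) \<longleftrightarrow> (\<exists>h. z2_boundary p X h \<and> b = h + c)" for b
    by (metis add_diff_cancel diff_add_cancel)
  then show ?thesis by (auto simp: z2_class_def r_coset_def)
qed

lemma z2_class_eq_iff: "z2_class p X c = z2_class p X d \<longleftrightarrow> z2_boundary p X (c - d)"
proof
  assume "z2_class p X c = z2_class p X d"
  moreover have "c \<in> z2_class p X c" by (simp add: z2_class_eq z2_boundary_0)
  ultimately show "z2_boundary p X (c - d)" by (simp add: z2_class_eq)
next
  assume cd: "z2_boundary p X (c - d)"
  have "z2_boundary p X (b - c) \<longleftrightarrow> z2_boundary p X (b - d)" for b
  proof -
    have "b - c + (c - d) = b - d" "b - d - (c - d) = b - c" by simp_all
    then show ?thesis using z2_boundary_add[OF _ cd] z2_boundary_diff[OF _ cd] by metis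
  qed
  then show "z2_class p X c = z2_class p X d" unfolding z2_class_eq by (intro Collect_cong)
qed

lemma carrier_z2_homology: "carrier (z2_homology p X) = z2_class p X ` Collect (z2_cycle p X)"
  by (auto simp: z2_homology_def carrier_FactGroup z2_class_def)

lemma z2_class_in_carrier: "z2_cycle p X c \<Longrightarrow> z2_class p X c \<in> carrier (z2_homology p X)"
  by (simp add: carrier_z2_homology)

lemma z2_homology_cases:
  assumes "x \<in> carrier (z2_homology p X)"
  obtains c where "z2_cycle p X c" "x = z2_class p X c"
  using assms by (auto simp: carrier_z2_homology)

lemma mult_z2_homology:
  "z2_cycle p X c \<Longrightarrow> z2_cycle p X d \<Longrightarrow>
   z2_class p X c \<otimes>\<^bsub>z2_homology p X\<^esub> z2_class p X d = z2_class p X (c + d)"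
  using normal.rcos_sum[OF normal_z2_boundary, of c p X d]
  by (simp add: z2_homology_def z2_class_def)

lemma chain_map_z2_cycle:
  assumes f: "continuous_map X Y f" and "z2_cycle p X c"
  shows "z2_cycle p Y (chain_map p f c)"
proof -
  obtain e where e: "singular_chain (p - 1) X e" "chain_boundary p c = e + e" "singular_chain p X c"
    using assms unfolding z2_cycle_def by blast
  then have "chain_boundary p (chain_map p f c) = chain_map (p - 1) f e + chain_map (p - 1) f e"
    by (simp add: chain_boundary_chain_map chain_map_add)
  then show ?thesis using e f singular_chain_chain_map unfolding z2_cycle_def by blast
qed

lemma chain_map_z2_boundary:
  assumes f: "continuous_map X Y f" and "z2_boundary p X c"
  shows "z2_boundary p Y (chain_map p f c)"
proof -
  obtain d e where de: "singular_chain (Suc p) X d" "singular_chain p X e"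
    "c = chain_boundary (Suc p) d + (e + e)"
    using assms unfolding z2_boundary_def by blast
  then have "chain_map p f c = chain_boundary (Suc p) (chain_map (Suc p) f d) +
      (chain_map p f e + chain_map p f e)"
    by (simp add: chain_boundary_chain_map chain_map_add)
  then show ?thesis using de f singular_chain_chain_map unfolding z2_boundary_def by blast
qed

text \<open>The representative chosen by \<open>SOME\<close> differs from \<open>c\<close> by a
  mod-2 boundary, which \<open>f\<close> maps to a mod-2 boundary, so the choice does not affect the
  class.\<close>

lemma z2_induced_class:
  assumes f: "continuous_map X Y f" and c: "z2_cycle p X c"
  shows "z2_induced p X Y f (z2_class p X c) = z2_class p Y (chain_map p f c)"
proof -
  have "(SOME b. b \<in> z2_class p X c) \<in> z2_class p X c"
    by (rule someI[of _ c]) (simp add: z2_class_eq z2_boundary_0)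
  then have "z2_boundary p Y (chain_map p f ((SOME b. b \<in> z2_class p X c) - c))"
    using chain_map_z2_boundary[OF f] by (simp add: z2_class_eq)
  then show ?thesis
    unfolding z2_induced_def z2_class_def[symmetric]
    by (simp add: z2_class_in_carrier[OF c] z2_class_eq_iff chain_map_diff)
qed

lemma z2_induced_hom:
  assumes f: "continuous_map X Y f"
  shows "z2_induced p X Y f \<in> hom (z2_homology p X) (z2_homology p Y)"
proof (rule homI)
  fix x y assume "x \<in> carrier (z2_homology p X)" "y \<in> carrier (z2_homology p X)"
  then obtain c d where cd: "z2_cycle p X c" "x = z2_class p X c" "z2_cycle p X d" "y = z2_class p X d"
    by (metis z2_homology_cases)
  show "z2_induced p X Y f (x \<otimes>\<^bsub>z2_homology p X\<^esub> y) =
      z2_induced p X Y f x \<otimes>\<^bsub>z2_homology p Y\<^esub> z2_induced p X Y f y"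
    unfolding cd(2,4)
    by (simp add: cd(1,3) mult_z2_homology z2_induced_class[OF f] z2_cycle_add chain_map_z2_cycle[OF f] chain_map_add)
next
  fix x assume "x \<in> carrier (z2_homology p X)"
  then obtain c where "z2_cycle p X c" "x = z2_class p X c"
    by (rule z2_homology_cases)
  then show "z2_induced p X Y f x \<in> carrier (z2_homology p Y)"
    using f by (metis z2_induced_class z2_class_in_carrier chain_map_z2_cycle)
qed

lemma z2_induced_in_carrier:
  "continuous_map X Y f \<Longrightarrow> x \<in> carrier (z2_homology p X) \<Longrightarrow>
   z2_induced p X Y f x \<in> carrier (z2_homology p Y)"
  using z2_induced_hom hom_in_carrier by metis

lemma z2_induced_compose:
  assumes "continuous_map X Y f" "continuous_map Y Z g" "x \<in> carrier (z2_homology p X)"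
  shows "z2_induced p Y Z g (z2_induced p X Y f x) = z2_induced p X Z (g \<circ> f) x"
proof -
  obtain c where c: "z2_cycle p X c" "x = z2_class p X c"
    using assms(3) by (rule z2_homology_cases)
  show ?thesis
    unfolding c(2) using c(1) assms(1,2) continuous_map_compose[OF assms(1,2)] chain_map_z2_cycle[OF assms(1) c(1)]
    by (simp add: z2_induced_class chain_map_compose)
qed

section \<open>From integral acyclicity to mod-2 isomorphisms\<close>

lemma frag_double_eq_0_iff: "e + e = 0 \<longleftrightarrow> e = 0" for e :: "'a chain"
  by (simp add: poly_mapping_eq_iff lookup_add fun_eq_iff plus_poly_mapping.rep_eq)

text \<open>The integral cone is free, so integral acyclicity passes to the mod-2 cone: halving the
  boundary of a mod-2 cycle gives an integral cycle.\<close>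

lemma cone_acyclic_mod2:
  assumes f: "continuous_map X Y f" and ac: "cone_acyclic X Y f"
    and z: "cone_chain (Suc p) X Y z" and e: "cone_chain p X Y e"
    and dz: "cone_boundary (Suc p) f z = e + e"
  obtains w v where "cone_chain (Suc (Suc p)) X Y w" "cone_chain (Suc p) X Y v"
    "z = cone_boundary (Suc (Suc p)) f w + (v + v)"
proof -
  \<comment> \<open>Twice the boundary of \<open>e\<close> is the boundary of a boundary, and free
    abelian groups have no 2-torsion; so the half \<open>e\<close> is itself an integral
    cycle.\<close>
  have "cone_boundary p f e + cone_boundary p f e = 0"
    using cone_boundary_cone_boundary[OF f z] by (simp add: dz cone_boundary_add)
  then have "cone_boundary p f e = 0"
    by (simp add: prod_eq_iff frag_double_eq_0_iff)
  then obtain v where v: "cone_chain (Suc p) X Y v" "cone_boundary (Suc p) f v = e"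
    using ac e unfolding cone_acyclic_def by blast
  then have "cone_chain (Suc p) X Y (z - (v + v))" "cone_boundary (Suc p) f (z - (v + v)) = 0"
    using z by (simp_all add: cone_chain_diff cone_chain_add cone_boundary_add cone_boundary_diff dz)
  then obtain w where "cone_chain (Suc (Suc p)) X Y w" "cone_boundary (Suc (Suc p)) f w = z - (v + v)"
    using ac unfolding cone_acyclic_def by blast
  then show thesis using v that[of w v] by simp
qed

text \<open>If \<open>d\<close> witnesses that the image of \<open>c\<close> bounds, then
  \<open>(d, c)\<close> is a mod-2 cycle of the cone, and the second component of its filling bounds
  \<open>c\<close>. For a cycle \<open>c\<close> of \<open>Y\<close>, the filling of
  \<open>(c, 0)\<close> contains, up to sign, a cycle of \<open>X\<close> mapping to the class of
  \<open>c\<close>.\<close>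

lemma bij_betw_z2_induced:
  assumes f: "continuous_map X Y f" and ac: "cone_acyclic X Y f"
  shows "bij_betw (z2_induced p X Y f) (carrier (z2_homology p X)) (carrier (z2_homology p Y))"
proof (rule bij_betw_imageI)
  have "z2_boundary p X c" if c: "z2_cycle p X c" and fc: "z2_boundary p Y (chain_map p f c)" for c
  proof -
    obtain d e where de: "singular_chain (Suc p) Y d" "singular_chain p Y e"
      "chain_map p f c = chain_boundary (Suc p) d + (e + e)"
      using fc unfolding z2_boundary_def by blast
    obtain e' where e': "singular_chain (p - 1) X e'" "chain_boundary p c = e' + e'" "singular_chain p X c"
      using c unfolding z2_cycle_def by blast
    have "cone_chain (Suc p) X Y (d, c)" using de e' by (simp add: cone_chain_def)
    moreover have "cone_boundary (Suc p) f (d, c) = (- e, - e') + (- e, - e')"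
      using de e' by (simp add: cone_boundary_def)
    \<comment> \<open>A cone chain of degree 0 must have second component 0. This holds because
      twice \<open>e'\<close> is the boundary of a 0-chain, hence 0.\<close>
    moreover have "cone_chain p X Y (- e, - e')"
    proof (cases "p = 0")
      case True
      then have "e' = 0" using e' by (simp add: chain_boundary_def frag_double_eq_0_iff)
      then show ?thesis using True de by (simp add: cone_chain_def singular_chain_minus)
    qed (use de e' in \<open>simp add: cone_chain_def singular_chain_minus\<close>)
    ultimately obtain w v where w: "cone_chain (Suc (Suc p)) X Y w" and v: "cone_chain (Suc p) X Y v"
      and eq: "(d, c) = cone_boundary (Suc (Suc p)) f w + (v + v)"
      using cone_acyclic_mod2[OF f ac] by metis
    from arg_cong[OF eq, of snd] have "c = chain_boundary (Suc p) (- snd w) + (snd v + snd v)"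
      by (simp add: cone_boundary_def chain_boundary_minus)
    then show ?thesis
      using w v unfolding z2_boundary_def cone_chain_def
      by (metis diff_Suc_1 nat.distinct(1) singular_chain_minus)
  qed
  note inj = this
  show "inj_on (z2_induced p X Y f) (carrier (z2_homology p X))"
  proof (rule inj_onI)
    fix x y assume "x \<in> carrier (z2_homology p X)" "y \<in> carrier (z2_homology p X)"
      and eq: "z2_induced p X Y f x = z2_induced p X Y f y"
    then obtain c d where cd: "z2_cycle p X c" "x = z2_class p X c" "z2_cycle p X d" "y = z2_class p X d"
      by (metis z2_homology_cases)
    then have "z2_boundary p Y (chain_map p f (c - d))"
      using eq by (simp add: z2_induced_class[OF f] z2_class_eq_iff chain_map_diff)
    then have "z2_boundary p X (c - d)"
      using inj z2_cycle_diff cd(1,3) by blast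
    then show "x = y" by (simp add: cd(2,4) z2_class_eq_iff)
  qed
  have "\<exists>b. z2_cycle p X b \<and> z2_boundary p Y (c - chain_map p f b)" if c: "z2_cycle p Y c" for c
  proof (cases p)
    \<comment> \<open>\<open>cone_acyclic_mod2\<close> treats positive degrees only. In degree 0
      every chain is a cycle, and integral acyclicity applies to \<open>(c, 0)\<close>
      directly.\<close>
    case 0
    have "cone_chain 0 X Y (c, 0)" "cone_boundary 0 f (c, 0) = 0"
      using c 0 by (auto simp: cone_chain_def cone_boundary_def z2_cycle_def chain_boundary_def zero_prod_def)
    then obtain w where w: "cone_chain 1 X Y w" "cone_boundary 1 f w = (c, 0)"
      using ac unfolding cone_acyclic_def by (metis One_nat_def)
    have "z2_cycle p X (- snd w)"
      using w 0 singular_chain_0 by (fastforce simp: z2_cycle_def cone_chain_def singular_chain_minus chain_boundary_def)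
    moreover have "c - chain_map p f (- snd w) = chain_boundary (Suc p) (fst w) + (0 + 0)"
      using arg_cong[OF w(2), of fst] 0 by (simp add: cone_boundary_def chain_map_minus algebra_simps)
    then have "z2_boundary p Y (c - chain_map p f (- snd w))"
      using w 0 unfolding z2_boundary_def cone_chain_def by (metis One_nat_def singular_chain_0)
    ultimately show ?thesis by blast
  next
    case (Suc q)
    obtain e where e: "singular_chain q Y e" "chain_boundary p c = e + e" "singular_chain p Y c"
      using c Suc unfolding z2_cycle_def by auto
    have "cone_chain (Suc q) X Y (c, 0)" "cone_chain q X Y (e, 0)"
      "cone_boundary (Suc q) f (c, 0) = (e, 0) + (e, 0)"
      using e Suc by (auto simp: cone_chain_def cone_boundary_def)
    then obtain w v where w: "cone_chain (Suc p) X Y w" and v: "cone_chain p X Y v"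
      and eq: "(c, 0) = cone_boundary (Suc p) f w + (v + v)"
      using cone_acyclic_mod2[OF f ac] Suc by metis
    have "chain_boundary p (- snd w) = - snd v + - snd v"
      using arg_cong[OF eq, of snd] by (simp add: cone_boundary_def chain_boundary_minus algebra_simps)
    then have "z2_cycle p X (- snd w)"
      using w v Suc unfolding z2_cycle_def cone_chain_def
      by (metis diff_Suc_1 nat.distinct(1) singular_chain_minus)
    moreover have "c - chain_map p f (- snd w) = chain_boundary (Suc p) (fst w) + (fst v + fst v)"
      using arg_cong[OF eq, of fst] by (simp add: cone_boundary_def chain_map_minus)
    then have "z2_boundary p Y (c - chain_map p f (- snd w))"
      using w v unfolding z2_boundary_def cone_chain_def by metis
    ultimately show ?thesis by blast
  qed
  note surj = this
  show "z2_induced p X Y f ` carrier (z2_homology p X) = carrier (z2_homology p Y)"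
  proof
    show "carrier (z2_homology p Y) \<subseteq> z2_induced p X Y f ` carrier (z2_homology p X)"
    proof
      fix y assume "y \<in> carrier (z2_homology p Y)"
      then obtain c where c: "z2_cycle p Y c" "y = z2_class p Y c"
        by (rule z2_homology_cases)
      then obtain b where b: "z2_cycle p X b" "z2_boundary p Y (c - chain_map p f b)"
        using surj by blast
      then have "y = z2_induced p X Y f (z2_class p X b)"
        by (simp add: c(2) z2_induced_class[OF f] z2_class_eq_iff)
      then show "y \<in> z2_induced p X Y f ` carrier (z2_homology p X)"
        using z2_class_in_carrier[OF b(1)] by blast
    qed
  qed (auto simp: z2_induced_in_carrier f)
qed

section \<open>The nerve theorem\<close>

lemma nerve_real_eq: "nerve_real I U = top_of_set (realization_set I (nerve I U))"
  by (simp add: nerve_real_def realization_def euclidean_product_topology)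

lemma in_realization_nerve_iff:
  "t \<in> realization_set I (nerve I U) \<longleftrightarrow>
     (\<forall>i. 0 \<le> t i) \<and> (\<forall>i. i \<notin> I \<longrightarrow> t i = 0) \<and> sum t I = 1 \<and>
     (\<exists>x. \<forall>i\<in>I. t i \<noteq> 0 \<longrightarrow> x \<in> U i)"
proof -
  have "{i \<in> I. t i \<noteq> 0} \<noteq> {}" if "sum t I = 1"
    using that by (metis (mono_tags, lifting) empty_Collect_eq sum.neutral zero_neq_one)
  then show ?thesis
    by (auto simp: realization_set_def nerve_def)
qed

text \<open>Among the simplices whose closed face contains \<open>t\<close>, the support of
  \<open>t\<close> is the smallest and so has the largest intersection of cover sets. The union over
  all simplices thus reduces to a condition on the support, which is easy to follow along
  segments.\<close>

lemma in_delta_set_iff: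
  "(t, x) \<in> delta_set I U \<longleftrightarrow>
     (\<forall>i. 0 \<le> t i) \<and> (\<forall>i. i \<notin> I \<longrightarrow> t i = 0) \<and> sum t I = 1 \<and> (\<forall>i\<in>I. t i \<noteq> 0 \<longrightarrow> x \<in> U i)"
  (is "_ \<longleftrightarrow> ?R")
proof
  assume ?R
  then have t: "t \<in> realization_set I (nerve I U)" by (auto simp: in_realization_nerve_iff)
  then have "{i \<in> I. t i \<noteq> 0} \<in> nerve I U" by (simp add: realization_set_def)
  then show "(t, x) \<in> delta_set I U"
    using \<open>?R\<close> t unfolding delta_set_def by (intro UN_I[of "{i \<in> I. t i \<noteq> 0}"]) auto
qed (auto simp: delta_set_def in_realization_nerve_iff)

lemma delta_set_subset:
  "delta_set I U \<subseteq> realization_set I (nerve I U) \<times> cover_space I U"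
proof
  fix z assume z: "z \<in> delta_set I U"
  obtain t x where [simp]: "z = (t, x)" by (cases z)
  have *: "sum t I = 1" "\<forall>i\<in>I. t i \<noteq> 0 \<longrightarrow> x \<in> U i" using z by (auto simp: in_delta_set_iff)
  then have "\<exists>i\<in>I. t i \<noteq> 0" by (metis sum.neutral zero_neq_one)
  then show "z \<in> realization_set I (nerve I U) \<times> cover_space I U"
    using * z by (auto simp: cover_space_def in_delta_set_iff in_realization_nerve_iff)
qed

lemma prod_topology_top_of_set: "prod_topology (top_of_set A) (top_of_set B) = top_of_set (A \<times> B)"
proof -
  have "A \<times> UNIV \<inter> A \<times> B = A \<times> B" by auto
  then show ?thesis by (simp add: prod_topology_subtopology subtopology_subtopology)
qed

lemma delta_space_eq: "delta_space I U = top_of_set (delta_set I U)"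
  using delta_set_subset[of I U]
  by (simp add: delta_space_def nerve_real_eq prod_topology_top_of_set subtopology_subtopology inf_absorb2)

lemma continuous_map_fst_delta: "continuous_map (delta_space I U) (nerve_real I U) fst"
  using delta_set_subset[of I U] continuous_on_fst[OF continuous_on_id, of "delta_set I U"]
  by (auto simp: delta_space_eq nerve_real_eq)

lemma continuous_map_snd_delta:
  "continuous_map (delta_space I U) (top_of_set (cover_space I U)) snd"
  using delta_set_subset[of I U] by (auto simp: delta_space_eq intro!: continuous_intros)

section \<open>Straight-line homotopies and the projection to the space\<close>

lemma continuous_on_segment:
  fixes f g :: "'a::topological_space \<Rightarrow> 'i \<Rightarrow> real"
  assumes "continuous_on S f" "continuous_on S g"
  shows "continuous_on ({0..1} \<times> S) (\<lambda>z i. (1 - fst z) * f (snd z) i + fst z * g (snd z) i)"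
proof (rule continuous_on_coordinatewise_then_product)
  fix i
  have "continuous_on ({0..1::real} \<times> S) (\<lambda>z. h (snd z) i)" if "continuous_on S h" for h :: "'a \<Rightarrow> 'i \<Rightarrow> real"
    by (rule continuous_on_compose2[OF continuous_on_product_then_coordinatewise[OF that]]) (auto intro: continuous_intros)
  then show "continuous_on ({0..1} \<times> S) (\<lambda>z. (1 - fst z) * f (snd z) i + fst z * g (snd z) i)"
    using assms by (intro continuous_intros)
qed

lemma homotopic_with_segment:
  fixes f g :: "'a::topological_space \<Rightarrow> 'i \<Rightarrow> real"
  assumes "continuous_on S f" "continuous_on S g"
    and "\<And>s x. 0 \<le> s \<Longrightarrow> s \<le> 1 \<Longrightarrow> x \<in> S \<Longrightarrow> (\<lambda>i. (1 - s) * f x i + s * g x i) \<in> T"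
  shows "homotopic_with (\<lambda>_. True) (top_of_set S) (top_of_set T) f g"
  unfolding homotopic_with_def
  by (intro exI[of _ "\<lambda>z i. (1 - fst z) * f (snd z) i + fst z * g (snd z) i"])
    (use assms continuous_on_segment[OF assms(1,2)] in
      \<open>auto simp: prod_topology_top_of_set image_subset_iff\<close>)

lemma homotopic_with_segment_Pair:
  fixes f g :: "'a::topological_space \<Rightarrow> 'i \<Rightarrow> real" and h :: "'a \<Rightarrow> 'b::topological_space"
  assumes "continuous_on S f" "continuous_on S g" "continuous_on S h"
    and "\<And>s x. 0 \<le> s \<Longrightarrow> s \<le> 1 \<Longrightarrow> x \<in> S \<Longrightarrow> (\<lambda>i. (1 - s) * f x i + s * g x i, h x) \<in> T"
  shows "homotopic_with (\<lambda>_. True) (top_of_set S) (top_of_set T) (\<lambda>x. (f x, h x)) (\<lambda>x. (g x, h x))"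
proof -
  have "continuous_on ({0..1::real} \<times> S) (\<lambda>z. h (snd z))"
    by (rule continuous_on_compose2[OF assms(3)]) (auto intro: continuous_intros)
  then show ?thesis
    unfolding homotopic_with_def
    by (intro exI[of _ "\<lambda>z. (\<lambda>i. (1 - fst z) * f (snd z) i + fst z * g (snd z) i, h (snd z))"])
      (use assms continuous_on_segment[OF assms(1,2)] in
        \<open>auto simp: prod_topology_top_of_set image_subset_iff intro!: continuous_on_Pair\<close>)
qed

text \<open>The normalized distances to the complements are positive only on the respective cover
  sets, so the support of \<open>g x\<close> consists of indices of sets containing
  \<open>x\<close>.\<close>

lemma partition_of_unity_section:
  fixes U :: "'i \<Rightarrow> 'a::metric_space set"
  assumes "is_cover I U"
  obtains g where "continuous_on (cover_space I U) g"
    "\<And>x. x \<in> cover_space I U \<Longrightarrow> (g x, x) \<in> delta_set I U"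
proof -
  have fin: "finite I" and op: "\<And>i. i \<in> I \<Longrightarrow> open (U i)" using assms by (auto simp: is_cover_def)
  \<comment> \<open>\<open>infdist\<close> to the empty set is 0 by convention, which would give the
    wrong weight to a set that is the whole space; hence the value 1.\<close>
  define d where "d = (\<lambda>i x. if U i = UNIV then 1 else infdist x (- U i))"
  have d_cont: "continuous_on S (d i)" for i S
    by (cases "U i = UNIV") (auto simp: d_def intro!: continuous_intros)
  have d0: "d i x = 0" if "x \<notin> U i" for i x using that by (auto simp: d_def)
  have dpos: "d i x > 0" if "x \<in> U i" "i \<in> I" for i x
    using that op infdist_pos_not_in_closed[of "- U i" x] by (auto simp: d_def)
  have dnn: "d i x \<ge> 0" for i x by (simp add: d_def infdist_nonneg)
  have spos: "(\<Sum>k\<in>I. d k x) > 0" if "x \<in> cover_space I U" for x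
    using that fin dnn dpos unfolding cover_space_def by (auto intro: sum_pos2)
  define g where "g = (\<lambda>x i. if i \<in> I then d i x / (\<Sum>k\<in>I. d k x) else 0)"
  show thesis
  proof
    show "continuous_on (cover_space I U) g"
    proof (rule continuous_on_coordinatewise_then_product)
      fix i
      show "continuous_on (cover_space I U) (\<lambda>x. g x i)"
        using spos d_cont by (cases "i \<in> I") (force simp: g_def intro!: continuous_intros)+
    qed
    show "(g x, x) \<in> delta_set I U" if x: "x \<in> cover_space I U" for x
      using spos[OF x] d0 dnn sum_divide_distrib[of "\<lambda>i. d i x" I "\<Sum>k\<in>I. d k x"]
      by (auto simp: in_delta_set_iff g_def sum_nonneg)
  qed
qed

text \<open>The fibre over \<open>x\<close> is the full simplex on the indices of the sets
  containing \<open>x\<close>. It is convex, so the segment from \<open>g x\<close> to any other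
  point of the fibre stays in the blow-up.\<close>

lemma cone_acyclic_snd_delta:
  fixes U :: "'i \<Rightarrow> 'a::metric_space set"
  assumes "is_cover I U"
  shows "cone_acyclic (delta_space I U) (top_of_set (cover_space I U)) snd"
proof -
  obtain g where g: "continuous_on (cover_space I U) g"
    "\<And>x. x \<in> cover_space I U \<Longrightarrow> (g x, x) \<in> delta_set I U"
    using partition_of_unity_section[OF assms] by blast
  have snd: "snd ` delta_set I U \<subseteq> cover_space I U" using delta_set_subset[of I U] by force
  show ?thesis
  proof (rule cone_acyclic_homotopy_equivalence[OF continuous_map_snd_delta])
    show c: "continuous_map (top_of_set (cover_space I U)) (delta_space I U) (\<lambda>x. (g x, x))"
      using g by (auto simp: delta_space_eq intro!: continuous_on_Pair continuous_intros)
    have "homotopic_with (\<lambda>_. True) (delta_space I U) (delta_space I U)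
        (\<lambda>z. (g (snd z), snd z)) (\<lambda>z. (fst z, snd z))"
      unfolding delta_space_eq
    proof (rule homotopic_with_segment_Pair)
      show "continuous_on (delta_set I U) (\<lambda>z. g (snd z))"
        by (rule continuous_on_compose2[OF g(1)]) (use snd in \<open>auto intro: continuous_intros\<close>)
      show "(\<lambda>i. (1 - s) * g (snd z) i + s * fst z i, snd z) \<in> delta_set I U"
        if "0 \<le> s" "s \<le> 1" "z \<in> delta_set I U" for s z
      proof -
        have "(g (snd z), snd z) \<in> delta_set I U" "(fst z, snd z) \<in> delta_set I U"
          using g(2) snd that by auto
        then show ?thesis
          using that(1,2) unfolding in_delta_set_iff
          by (auto simp: sum.distrib simp flip: sum_distrib_left)
      qed
    qed (auto intro: continuous_intros)
    then show "homotopic_with (\<lambda>x. True) (delta_space I U) (delta_space I U) ((\<lambda>x. (g x, x)) \<circ> snd) id"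
      by (simp add: o_def id_def)
    show "homotopic_with (\<lambda>x. True) (top_of_set (cover_space I U)) (top_of_set (cover_space I U))
        (snd \<circ> (\<lambda>x. (g x, x))) id"
      by (simp add: o_def id_def)
  qed
qed

section \<open>Open stars and the projection to the nerve\<close>

definition nerve_star :: "'i set \<Rightarrow> ('i \<Rightarrow> 'a set) \<Rightarrow> 'i set \<Rightarrow> ('i \<Rightarrow> real) set" where
  "nerve_star I U J = {t \<in> realization_set I (nerve I U). \<forall>j\<in>J. t j \<noteq> 0}"

definition barycenter :: "'i set \<Rightarrow> 'i \<Rightarrow> real" where
  "barycenter J i = (if i \<in> J then 1 / card J else 0)"

lemma sum_barycenter:
  assumes "J \<subseteq> I" "J \<noteq> {}" "finite I"
  shows "sum (barycenter J) I = 1"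
proof -
  have "finite J" using assms finite_subset by blast
  then show ?thesis
    using assms unfolding barycenter_def by (simp add: sum.If_cases inf_absorb2)
qed

text \<open>\<open>J\<close> lies in the support of \<open>t\<close>, so moving towards its
  barycenter adds no vertex to the support. The weights on \<open>J\<close> stay positive: for
  \<open>s < 1\<close> because of \<open>t\<close>, for \<open>s = 1\<close> because of the
  barycenter.\<close>

lemma segment_to_barycenter_in_delta_set:
  assumes J: "J \<subseteq> I" "J \<noteq> {}" "finite I" and t: "(t, x) \<in> delta_set I U" "\<forall>j\<in>J. t j \<noteq> 0"
    and s: "0 \<le> s" "s \<le> 1"
  shows "(\<lambda>i. (1 - s) * t i + s * barycenter J i, x) \<in> delta_set I U"
    and "\<forall>j\<in>J. (1 - s) * t j + s * barycenter J j \<noteq> 0"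
proof -
  have "card J > 0" using J finite_subset by (auto simp: card_gt_0_iff)
  then have bpos: "j \<in> J \<Longrightarrow> barycenter J j > 0" and bnn: "barycenter J j \<ge> 0" for j
    by (simp_all add: barycenter_def)
  note sum_barycenter[OF J]
  moreover have "i \<notin> J \<Longrightarrow> barycenter J i = 0" for i by (simp add: barycenter_def)
  ultimately show "(\<lambda>i. (1 - s) * t i + s * barycenter J i, x) \<in> delta_set I U"
    using J s t bnn unfolding in_delta_set_iff
    by (auto simp: sum.distrib simp flip: sum_distrib_left)
  show "\<forall>j\<in>J. (1 - s) * t j + s * barycenter J j \<noteq> 0"
  proof
    fix j assume j: "j \<in> J"
    then have "t j > 0" using t by (metis in_delta_set_iff order_less_le)
    then show "(1 - s) * t j + s * barycenter J j \<noteq> 0"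
      using bpos[OF j] s by (cases "s = 1") (auto simp: add_pos_nonneg less_imp_neq[symmetric])
  qed
qed

text \<open>Each \<open>t\<close> lifts to a point \<open>(t, x)\<close> of the blow-up, with
  \<open>x\<close> common to the sets over its support; the segment found there projects to the
  star.\<close>

lemma contractible_nerve_star:
  assumes J: "J \<subseteq> I" "J \<noteq> {}" "finite I"
  shows "contractible (nerve_star I U J)"
  unfolding contractible_def
proof (intro exI)
  show "homotopic_with_canon (\<lambda>x. True) (nerve_star I U J) (nerve_star I U J) id (\<lambda>_. barycenter J)"
  proof (rule homotopic_with_segment)
    fix s t assume s: "0 \<le> s" "s \<le> (1::real)" and t: "t \<in> nerve_star I U J"
    then obtain x where "(t, x) \<in> delta_set I U" "\<forall>j\<in>J. t j \<noteq> 0"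
      by (auto simp: nerve_star_def in_realization_nerve_iff in_delta_set_iff)
    from segment_to_barycenter_in_delta_set[OF J this s]
    show "(\<lambda>i. (1 - s) * id t i + s * barycenter J i) \<in> nerve_star I U J"
      using delta_set_subset[of I U] by (auto simp: nerve_star_def)
  qed (auto intro: continuous_intros)
qed

text \<open>The order of the two stages matters: \<open>x\<close> may move freely in the
  intersection over \<open>J\<close> only once \<open>t\<close> has reached the barycenter, because
  before that it must stay in the sets over the whole support of \<open>t\<close>.\<close>

lemma contractible_delta_over_nerve_star:
  assumes J: "J \<subseteq> I" "J \<noteq> {}" "finite I" and c: "contractible (\<Inter>i\<in>J. U i)"
  shows "contractible (delta_set I U \<inter> fst -` nerve_star I U J)" (is "contractible ?D")
proof -
  let ?V = "\<Inter>i\<in>J. U i"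
  obtain a where a: "homotopic_with_canon (\<lambda>x. True) ?V ?V id (\<lambda>_. a)"
    using c unfolding contractible_def by blast
  have D: "(t, x) \<in> ?D \<longleftrightarrow> (t, x) \<in> delta_set I U \<and> (\<forall>j\<in>J. t j \<noteq> 0)" for t x
    using delta_set_subset[of I U] by (auto simp: nerve_star_def)
  have "homotopic_with_canon (\<lambda>_. True) ?D ?D (\<lambda>z. (fst z, snd z)) (\<lambda>z. (barycenter J, snd z))"
  proof (rule homotopic_with_segment_Pair)
    fix s z assume s: "0 \<le> s" "s \<le> (1::real)" and z: "z \<in> ?D"
    then have "(fst z, snd z) \<in> delta_set I U" "\<forall>j\<in>J. fst z j \<noteq> 0" by (auto simp: nerve_star_def)
    from segment_to_barycenter_in_delta_set[OF J this s]
    show "(\<lambda>i. (1 - s) * fst z i + s * barycenter J i, snd z) \<in> ?D"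
      unfolding D by blast
  qed (auto intro: continuous_intros)
  moreover have "homotopic_with_canon (\<lambda>_. True) ?D ?D
     ((\<lambda>x. (barycenter J, x)) \<circ> (id \<circ> snd)) ((\<lambda>x. (barycenter J, x)) \<circ> ((\<lambda>_. a) \<circ> snd))"
  proof (rule homotopic_with_compose_continuous_map_left)
    show "homotopic_with (\<lambda>_. True) (top_of_set ?D) (top_of_set ?V) (id \<circ> snd) ((\<lambda>_. a) \<circ> snd)"
    proof (rule homotopic_with_compose_continuous_map_right[OF a])
      show "continuous_map (top_of_set ?D) (top_of_set ?V) snd"
        using J by (auto simp: nerve_star_def in_delta_set_iff intro!: continuous_intros)
    qed auto
    have "(barycenter J, x) \<in> ?D" if x: "x \<in> ?V" for x
    proof -
      have "card J > 0" using J finite_subset by (auto simp: card_gt_0_iff)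
      then show ?thesis
        using x J sum_barycenter[OF J] unfolding D in_delta_set_iff by (auto simp: barycenter_def)
    qed
    then show "continuous_map (top_of_set ?V) (top_of_set ?D) (\<lambda>x. (barycenter J, x))"
      by (auto intro!: continuous_intros)
  qed auto
  ultimately have "homotopic_with_canon (\<lambda>_. True) ?D ?D id (\<lambda>z. (barycenter J, a))"
    by (auto simp: o_def id_def intro: homotopic_with_trans)
  then show ?thesis unfolding contractible_def by blast
qed

lemma openin_nerve_star:
  assumes "finite J"
  shows "openin (nerve_real I U) (nerve_star I U J)"
proof -
  have "open (\<Inter>j\<in>J. {t :: 'a \<Rightarrow> real. t j \<noteq> 0})"
    using assms by (intro open_INT ballI open_Collect_neq continuous_on_product_coordinates) auto
  moreover have "nerve_star I U J = realization_set I (nerve I U) \<inter> (\<Inter>j\<in>J. {t. t j \<noteq> 0})"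
    by (auto simp: nerve_star_def)
  ultimately show ?thesis by (simp add: nerve_real_eq openin_open_Int)
qed

theorem nerve_theorem_cone_acyclic:
  assumes fin: "finite I" and good: "good_cover I U"
  shows "cone_acyclic (delta_space I U) (nerve_real I U) fst"
proof -
  let ?X = "delta_space I U" and ?Y = "nerve_real I U"
  define \<A> where "\<A> = nerve_star I U ` {J. J \<subseteq> I \<and> J \<noteq> {}}"
  define \<F> where "\<F> = (\<lambda>i. nerve_star I U {i}) ` I"
  have "cone_acyclic (subtopology ?X (fst -` \<Union>\<F>)) (subtopology ?Y (\<Union>\<F>)) fst"
  proof (rule cone_acyclic_Union[OF continuous_map_fst_delta, of \<A>])
    show "openin ?Y A" if "A \<in> \<A>" for A
      using that fin by (auto simp: \<A>_def intro: openin_nerve_star finite_subset)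
    show "A \<inter> B \<in> \<A>" if AB: "A \<in> \<A>" "B \<in> \<A>" for A B
    proof -
      obtain J K where JK: "A = nerve_star I U J" "B = nerve_star I U K" "J \<subseteq> I" "K \<subseteq> I" "J \<noteq> {}"
        using AB by (auto simp: \<A>_def)
      then have "A \<inter> B = nerve_star I U (J \<union> K)" by (auto simp: nerve_star_def)
      then show ?thesis using JK unfolding \<A>_def by blast
    qed
    show "cone_acyclic (subtopology ?X (fst -` A)) (subtopology ?Y A) fst" if A: "A \<in> \<A>" for A
    proof -
      obtain J where J: "A = nerve_star I U J" "J \<subseteq> I" "J \<noteq> {}" using A by (auto simp: \<A>_def)
      have Y: "subtopology ?Y A = top_of_set (nerve_star I U J)"
        by (auto simp: nerve_real_eq subtopology_subtopology J nerve_star_def intro!: arg_cong2[where f = subtopology])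
      have X: "subtopology ?X (fst -` A) = top_of_set (delta_set I U \<inter> fst -` nerve_star I U J)"
        by (simp add: delta_space_eq subtopology_subtopology J)
      show ?thesis
      \<comment> \<open>An empty star, as for \<open>J\<close> outside the nerve, offers no point
        for a constant map; over it both spaces are empty.\<close>
      proof (cases "A = {}")
        case True
        then show ?thesis by (intro cone_acyclic_empty) auto
      next
        case False
        then obtain t where t: "t \<in> nerve_star I U J" using J by auto
        then obtain x where x': "(t, x) \<in> delta_set I U"
          by (auto simp: nerve_star_def in_realization_nerve_iff in_delta_set_iff)
        then have x: "x \<in> (\<Inter>i\<in>J. U i)"
          using J t by (auto simp: nerve_star_def in_delta_set_iff)
        then have ne: "topspace (subtopology ?X (fst -` A)) \<noteq> {}"
          using t x' unfolding X by auto
        have "contractible (\<Inter>i\<in>J. U i)" using good J x unfolding good_cover_def by blast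
        then have "contractible_space (subtopology ?X (fst -` A))"
          unfolding X using J fin contractible_delta_over_nerve_star by fastforce
        moreover have "contractible_space (subtopology ?Y A)"
          unfolding Y using J fin contractible_nerve_star by fastforce
        moreover have "continuous_map (subtopology ?X (fst -` A)) (subtopology ?Y A) fst"
          using continuous_map_from_subtopology[OF continuous_map_fst_delta]
          by (auto simp: continuous_map_in_subtopology)
        ultimately show ?thesis using ne by (intro cone_acyclic_contractible)
      qed
    qed
    show "finite \<F>" "\<F> \<subseteq> \<A>" using fin by (auto simp: \<F>_def \<A>_def)
  qed
  moreover have "\<Union>\<F> = topspace ?Y"
  proof -
    have "\<exists>i\<in>I. t i \<noteq> 0" if "t \<in> realization_set I (nerve I U)" for t
      using that by (metis in_realization_nerve_iff sum.neutral zero_neq_one)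
    then show ?thesis by (auto simp: \<F>_def nerve_star_def nerve_real_eq)
  qed
  moreover have "topspace ?X \<subseteq> fst -` topspace ?Y"
    using continuous_map_fst_delta continuous_map_image_subset_topspace by fastforce
  ultimately show ?thesis by (simp add: subtopology_superset)
qed

section \<open>Naturality of the nerve isomorphism\<close>

lemma sum_lin_ext:
  assumes "finite I" "finite J" "\<And>i. i \<in> I \<Longrightarrow> F i \<in> J"
  shows "sum (lin_ext I F t) J = sum t I"
  unfolding lin_ext_def using assms by (intro sum.group) auto

text \<open>A vertex with nonzero weight in the image comes from a vertex \<open>i\<close> in the
  support of \<open>t\<close>, and \<open>x\<close> in \<open>U i\<close> implies \<open>x\<close>
  in \<open>V (F i)\<close>.\<close>

lemma lin_ext_in_delta_set:
  assumes "finite I" "finite J" and F: "map_of_covers I U J V F" and t: "(t, x) \<in> delta_set I U"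
  shows "(lin_ext I F t, x) \<in> delta_set J V"
proof -
  have "x \<in> V j" if j: "lin_ext I F t j \<noteq> 0" for j
  proof -
    obtain i where "i \<in> {i \<in> I. F i = j}" "t i \<noteq> 0"
      using sum.not_neutral_contains_not_neutral[OF j[unfolded lin_ext_def]] .
    then have "x \<in> U i" "U i \<subseteq> V j" using t F by (auto simp: in_delta_set_iff map_of_covers_def)
    then show ?thesis by blast
  qed
  moreover have "lin_ext I F t j = 0" if "j \<notin> J" for j
    unfolding lin_ext_def using that F by (intro sum.neutral) (auto simp: map_of_covers_def)
  ultimately show ?thesis
    using assms sum_lin_ext[of I J F t]
    by (auto simp: in_delta_set_iff map_of_covers_def lin_ext_def sum_nonneg)
qed

lemma continuous_on_lin_ext: "continuous_on S (lin_ext I F)"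
  unfolding lin_ext_def
proof (rule continuous_on_coordinatewise_then_product)
  show "continuous_on S (\<lambda>t. \<Sum>i\<in>{i \<in> I. F i = j}. t i)" for j
    by (intro continuous_on_sum continuous_on_product_then_coordinatewise[OF continuous_on_id])
qed

lemma continuous_map_lin_ext:
  assumes "finite I" "finite J" "map_of_covers I U J V F"
  shows "continuous_map (nerve_real I U) (nerve_real J V) (lin_ext I F)"
proof -
  have "lin_ext I F t \<in> realization_set J (nerve J V)" if t: "t \<in> realization_set I (nerve I U)" for t
  proof -
    obtain x where "(t, x) \<in> delta_set I U"
      using t by (auto simp: in_realization_nerve_iff in_delta_set_iff)
    then show ?thesis using lin_ext_in_delta_set[OF assms] delta_set_subset[of J V] by blast
  qed
  then show ?thesis by (auto simp: nerve_real_eq continuous_on_lin_ext)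
qed

lemma lin_ext_compose:
  assumes "finite I" "finite J" "\<And>i. i \<in> I \<Longrightarrow> F i \<in> J"
  shows "lin_ext J G (lin_ext I F t) = lin_ext I (\<lambda>i. G (F i)) t"
proof
  fix k
  have "lin_ext J G (lin_ext I F t) k =
      (\<Sum>j\<in>{j \<in> J. G j = k}. \<Sum>i\<in>{i \<in> {i \<in> I. G (F i) = k}. F i = j}. t i)"
    unfolding lin_ext_def by (intro sum.cong refl) auto
  also have "\<dots> = (\<Sum>i\<in>{i \<in> I. G (F i) = k}. t i)"
    using assms by (intro sum.group) auto
  finally show "lin_ext J G (lin_ext I F t) k = lin_ext I (\<lambda>i. G (F i)) t k"
    by (simp add: lin_ext_def)
qed

abbreviation nerve_induced where
  "nerve_induced p I U J V F \<equiv> z2_induced p (nerve_real I U) (nerve_real J V) (lin_ext I F)"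

abbreviation space_homology :: "nat \<Rightarrow> 'i set \<Rightarrow> ('i \<Rightarrow> 'a::topological_space set) \<Rightarrow> 'a chain set monoid" where
  "space_homology p I U \<equiv> z2_homology p (top_of_set (cover_space I U))"

abbreviation nerve_homology where
  "nerve_homology p I U \<equiv> z2_homology p (nerve_real I U)"

abbreviation inc_induced where
  "inc_induced p A B \<equiv> z2_induced p (top_of_set A) (top_of_set B) id"

text \<open>\<open>lin_ext I H\<close> sees \<open>H\<close> on \<open>I\<close> only, so coherence
  on indices already makes the realizations equal as maps.\<close>

lemma nerve_induced_compose:
  assumes fin: "finite I" "finite J" "finite K"
    and F: "map_of_covers I U J V F" and G: "map_of_covers J V K W G"
    and H: "\<And>i. i \<in> I \<Longrightarrow> G (F i) = H i" and x: "x \<in> carrier (nerve_homology p I U)"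
  shows "nerve_induced p J V K W G (nerve_induced p I U J V F x) = nerve_induced p I U K W H x"
proof -
  have "lin_ext J G (lin_ext I F t) = lin_ext I H t" for t
  proof -
    have "lin_ext J G (lin_ext I F t) = lin_ext I (\<lambda>i. G (F i)) t"
      using F fin by (intro lin_ext_compose) (auto simp: map_of_covers_def)
    also have "\<dots> = lin_ext I H t"
      unfolding lin_ext_def using H by (intro ext sum.cong) auto
    finally show ?thesis .
  qed
  then have "lin_ext J G \<circ> lin_ext I F = lin_ext I H" by auto
  then show ?thesis
    using z2_induced_compose[OF continuous_map_lin_ext[OF fin(1,2) F] continuous_map_lin_ext[OF fin(2,3) G] x]
    by simp
qed

lemma inc_induced_compose:
  assumes "A \<subseteq> B" "B \<subseteq> C" "x \<in> carrier (z2_homology p (top_of_set A))"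
  shows "inc_induced p B C (inc_induced p A B x) = inc_induced p A C x"
proof -
  have "continuous_map (top_of_set A) (top_of_set B) id" "continuous_map (top_of_set B) (top_of_set C) id"
    using assms by auto
  from z2_induced_compose[OF this assms(3)] show ?thesis by simp
qed

lemma inc_induced_in_carrier:
  "A \<subseteq> B \<Longrightarrow> x \<in> carrier (z2_homology p (top_of_set A)) \<Longrightarrow>
   inc_induced p A B x \<in> carrier (z2_homology p (top_of_set B))"
  by (rule z2_induced_in_carrier) auto

lemma inc_induced_hom:
  "A \<subseteq> B \<Longrightarrow> inc_induced p A B \<in> hom (z2_homology p (top_of_set A)) (z2_homology p (top_of_set B))"
  by (rule z2_induced_hom) auto

lemma group_z2_homology: "group (z2_homology p X)"
  unfolding z2_homology_def by (rule normal.factorgroup_is_group[OF normal_z2_boundary])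

lemma z2_induced_iso:
  "continuous_map X Y f \<Longrightarrow> cone_acyclic X Y f \<Longrightarrow>
   z2_induced p X Y f \<in> iso (z2_homology p X) (z2_homology p Y)"
  by (simp add: iso_def z2_induced_hom bij_betw_z2_induced)

lemma cover_space_mono: "map_of_covers I U J V F \<Longrightarrow> cover_space I U \<subseteq> cover_space J V"
  by (fastforce simp: map_of_covers_def cover_space_def)

lemma cover_sequenceD:
  assumes "cover_sequence I U F" "0 \<le> a"
  shows "is_cover (I a) (U a)"
    and "a \<le> a' \<Longrightarrow> map_of_covers (I a) (U a) (I a') (U a') (F a a')"
    and "i \<in> I a \<Longrightarrow> F a a i = i"
  using assms by (simp_all add: cover_sequence_def)

context
  fixes I :: "'i set" and U :: "'i \<Rightarrow> 'a::metric_space set"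
  assumes cover: "is_cover I U"
begin

lemma z2_induced_snd_delta_iso:
  "z2_induced p (delta_space I U) (top_of_set (cover_space I U)) snd
     \<in> iso (z2_homology p (delta_space I U)) (space_homology p I U)"
  by (intro z2_induced_iso continuous_map_snd_delta cone_acyclic_snd_delta cover)

lemma rho_hom: "rho p I U \<in> hom (space_homology p I U) (nerve_homology p I U)"
proof -
  have "inv_into (carrier (z2_homology p (delta_space I U)))
     (z2_induced p (delta_space I U) (top_of_set (cover_space I U)) snd)
     \<in> hom (space_homology p I U) (z2_homology p (delta_space I U))"
    using group.iso_set_sym[OF group_z2_homology z2_induced_snd_delta_iso] by (simp add: iso_def)
  then show ?thesis
    unfolding rho_def by (rule hom_compose[OF _ z2_induced_hom[OF continuous_map_fst_delta]])
qed

text \<open>This determines rho without \<open>inv_into\<close>, since every class of the space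
  lifts to the blow-up.\<close>

lemma rho_z2_induced_snd:
  assumes "y \<in> carrier (z2_homology p (delta_space I U))"
  shows "rho p I U (z2_induced p (delta_space I U) (top_of_set (cover_space I U)) snd y) =
     z2_induced p (delta_space I U) (nerve_real I U) fst y"
  using assms z2_induced_snd_delta_iso[of p] by (simp add: rho_def iso_def bij_betw_def inv_into_f_f)

lemma rho_iso:
  assumes "good_cover I U"
  shows "rho p I U \<in> iso (space_homology p I U) (nerve_homology p I U)"
proof -
  have "finite I" using cover by (simp add: is_cover_def)
  then have "z2_induced p (delta_space I U) (nerve_real I U) fst
      \<in> iso (z2_homology p (delta_space I U)) (nerve_homology p I U)"
    by (intro z2_induced_iso continuous_map_fst_delta nerve_theorem_cone_acyclic assms)
  then show ?thesis
    unfolding rho_def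
    by (rule iso_set_trans[OF group.iso_set_sym[OF group_z2_homology z2_induced_snd_delta_iso]])
qed

lemma rho_inv_hom:
  assumes "good_cover I U"
  shows "rho_inv p I U \<in> hom (nerve_homology p I U) (space_homology p I U)"
  using group.iso_set_sym[OF group_z2_homology rho_iso[OF assms]] by (simp add: rho_inv_def iso_def)

lemma rho_inv_in_carrier:
  "good_cover I U \<Longrightarrow> x \<in> carrier (nerve_homology p I U) \<Longrightarrow>
   rho_inv p I U x \<in> carrier (space_homology p I U)"
  using rho_inv_hom hom_in_carrier by metis

lemma rho_inv_rho:
  "good_cover I U \<Longrightarrow> x \<in> carrier (space_homology p I U) \<Longrightarrow> rho_inv p I U (rho p I U x) = x"
  using rho_iso[of p] by (simp add: rho_inv_def iso_def bij_betw_def inv_into_f_f)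

lemma rho_rho_inv:
  "good_cover I U \<Longrightarrow> x \<in> carrier (nerve_homology p I U) \<Longrightarrow> rho p I U (rho_inv p I U x) = x"
  using rho_iso[of p] by (simp add: rho_inv_def iso_def bij_betw_def f_inv_into_f)

end

text \<open>The map \<open>(t, x) \<mapsto> (|F| t, x)\<close> between the blow-ups covers both the inclusion and
  the map of nerves.\<close>

lemma rho_natural:
  fixes U :: "'i \<Rightarrow> 'a::metric_space set" and V :: "'j \<Rightarrow> 'a set"
  assumes U: "is_cover I U" and V: "is_cover J V" and F: "map_of_covers I U J V F"
    and x: "x \<in> carrier (space_homology p I U)"
  shows "rho p J V (inc_induced p (cover_space I U) (cover_space J V) x) =
     nerve_induced p I U J V F (rho p I U x)"
proof -
  have fin: "finite I" "finite J" using U V by (auto simp: is_cover_def)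
  define D where "D = (\<lambda>z :: ('i \<Rightarrow> real) \<times> 'a. (lin_ext I F (fst z), snd z))"
  have "continuous_on (delta_set I U) (\<lambda>z. lin_ext I F (fst z))"
    by (rule continuous_on_compose2[OF continuous_on_lin_ext continuous_on_fst[OF continuous_on_id] subset_UNIV])
  then have D: "continuous_map (delta_space I U) (delta_space J V) D"
    using lin_ext_in_delta_set[OF fin F] unfolding D_def delta_space_eq
    by (auto intro!: continuous_on_Pair continuous_on_snd continuous_on_id)
  have inc: "continuous_map (top_of_set (cover_space I U)) (top_of_set (cover_space J V)) id"
    using cover_space_mono[OF F] by auto
  \<comment> \<open>For a lift \<open>y\<close> of \<open>x\<close> to the blow-up, both sides
    become composites of induced maps, which agree already as maps of spaces.\<close>
  obtain y where y: "y \<in> carrier (z2_homology p (delta_space I U))"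
    and xy: "x = z2_induced p (delta_space I U) (top_of_set (cover_space I U)) snd y"
    using x z2_induced_snd_delta_iso[OF U, of p] unfolding iso_def bij_betw_def by blast
  note comp = z2_induced_compose[OF _ _ y]
  have "inc_induced p (cover_space I U) (cover_space J V) x =
      z2_induced p (delta_space J V) (top_of_set (cover_space J V)) snd
        (z2_induced p (delta_space I U) (delta_space J V) D y)"
    unfolding xy comp[OF continuous_map_snd_delta inc] comp[OF D continuous_map_snd_delta]
    by (simp add: D_def o_def)
  then have "rho p J V (inc_induced p (cover_space I U) (cover_space J V) x) =
      z2_induced p (delta_space J V) (nerve_real J V) fst
        (z2_induced p (delta_space I U) (delta_space J V) D y)"
    using rho_z2_induced_snd[OF V] z2_induced_in_carrier[OF D y] by simp
  also have "\<dots> = nerve_induced p I U J V F (z2_induced p (delta_space I U) (nerve_real I U) fst y)"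
    unfolding comp[OF D continuous_map_fst_delta]
      comp[OF continuous_map_fst_delta continuous_map_lin_ext[OF fin F]]
    by (simp add: D_def o_def)
  also have "\<dots> = nerve_induced p I U J V F (rho p I U x)"
    unfolding xy rho_z2_induced_snd[OF U y] ..
  finally show ?thesis .
qed

lemma rho_inv_natural:
  fixes U :: "'i \<Rightarrow> 'a::metric_space set" and V :: "'j \<Rightarrow> 'a set"
  assumes U: "is_cover I U" "good_cover I U" and V: "is_cover J V" "good_cover J V"
    and F: "map_of_covers I U J V F" and x: "x \<in> carrier (nerve_homology p I U)"
  shows "rho_inv p J V (nerve_induced p I U J V F x) =
     inc_induced p (cover_space I U) (cover_space J V) (rho_inv p I U x)"
proof -
  let ?y = "rho_inv p I U x"
  have y: "?y \<in> carrier (space_homology p I U)" by (rule rho_inv_in_carrier[OF U x])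
  have "nerve_induced p I U J V F x = rho p J V (inc_induced p (cover_space I U) (cover_space J V) ?y)"
    using rho_natural[OF U(1) V(1) F y] rho_rho_inv[OF U x] by simp
  then show ?thesis
    using rho_inv_rho[OF V] inc_induced_in_carrier[OF cover_space_mono[OF F] y] by simp
qed

section \<open>The interleaving and its four relations\<close>

theorem theorem16:
  fixes c :: real and p :: nat
    and IU :: "real \<Rightarrow> 'i set" and U :: "real \<Rightarrow> 'i \<Rightarrow> 'a::metric_space set"
    and FU :: "real \<Rightarrow> real \<Rightarrow> 'i \<Rightarrow> 'i"
    and IV :: "real \<Rightarrow> 'j set" and V :: "real \<Rightarrow> 'j \<Rightarrow> 'a set"
    and FV :: "real \<Rightarrow> real \<Rightarrow> 'j \<Rightarrow> 'j"
    and IW :: "real \<Rightarrow> 'k set" and W :: "real \<Rightarrow> 'k \<Rightarrow> 'a set"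
    and FW :: "real \<Rightarrow> real \<Rightarrow> 'k \<Rightarrow> 'k"
    and FVW :: "real \<Rightarrow> real \<Rightarrow> 'j \<Rightarrow> 'k"
    and FWV :: "real \<Rightarrow> real \<Rightarrow> 'k \<Rightarrow> 'j"
    and \<phi> :: "real \<Rightarrow> ('i \<Rightarrow> real) chain set \<Rightarrow> ('j \<Rightarrow> real) chain set"
    and \<psi> :: "real \<Rightarrow> ('j \<Rightarrow> real) chain set \<Rightarrow> ('i \<Rightarrow> real) chain set"
  assumes c: "1 \<le> c"
    and seqU: "cover_sequence IU U FU"
    and seqV: "cover_sequence IV V FV"
    and seqW: "cover_sequence IW W FW"
    and UV: "\<And>a. 0 \<le> a \<Longrightarrow> cover_space (IU a) (U a) \<subseteq> cover_space (IV a) (V a)"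
    and VW: "\<And>a. 0 \<le> a \<Longrightarrow> cover_space (IV a) (V a) \<subseteq> cover_space (IW a) (W a)"
    and WU: "\<And>a. 0 \<le> a \<Longrightarrow> cover_space (IW a) (W a) \<subseteq> cover_space (IU (c * a)) (U (c * a))"
    and mapVW: "\<And>a a'. 0 \<le> a \<Longrightarrow> a \<le> a' \<Longrightarrow>
                  map_of_covers (IV a) (V a) (IW a') (W a') (FVW a a')"
    and mapWV: "\<And>a a'. 0 \<le> a \<Longrightarrow> a \<le> a' \<Longrightarrow>
                  map_of_covers (IW a) (W a) (IV (c * a')) (V (c * a')) (FWV a a')"
    and coh1: "\<And>a a' a'' j. 0 \<le> a \<Longrightarrow> a \<le> a' \<Longrightarrow> a' \<le> a'' \<Longrightarrow> j \<in> IV a \<Longrightarrow>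
                  FW a' a'' (FVW a a' j) = FVW a' a'' (FV a a' j)"
    and coh2: "\<And>a a' j. 0 \<le> a \<Longrightarrow> a \<le> a' \<Longrightarrow> j \<in> IV (a / c) \<Longrightarrow>
                  FWV (a / c) a' (FVW (a / c) (a / c) j) = FV (a / c) (c * a') j"
    and goodU: "\<And>a. 0 \<le> a \<Longrightarrow> good_cover (IU a) (U a)"
    and goodW: "\<And>a. 0 \<le> a \<Longrightarrow> good_cover (IW a) (W a)"
    and phi_def: "\<And>a. \<phi> a = rho p (IV (c * a)) (V (c * a))
                   \<circ> z2_induced p (top_of_set (cover_space (IU a) (U a)))
                                   (top_of_set (cover_space (IV (c * a)) (V (c * a)))) id
                   \<circ> rho_inv p (IU a) (U a)"
    and psi_def: "\<And>a. \<psi> a = rho p (IU (c * a)) (U (c * a))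
                   \<circ> z2_induced p (top_of_set (cover_space (IW a) (W a)))
                                   (top_of_set (cover_space (IU (c * a)) (U (c * a)))) id
                   \<circ> rho_inv p (IW a) (W a)
                   \<circ> z2_induced p (nerve_real (IV a) (V a)) (nerve_real (IW a) (W a))
                                   (lin_ext (IV a) (FVW a a))"
  shows "c_approximate_via c
           (\<lambda>a. z2_homology p (nerve_real (IU a) (U a)))
           (\<lambda>a a'. z2_induced p (nerve_real (IU a) (U a)) (nerve_real (IU a') (U a'))
                              (lin_ext (IU a) (FU a a')))
           (\<lambda>a. z2_homology p (nerve_real (IV a) (V a)))
           (\<lambda>a a'. z2_induced p (nerve_real (IV a) (V a)) (nerve_real (IV a') (V a'))
                              (lin_ext (IV a) (FV a a')))
           \<phi> \<psi>
       \<and> c_approximate c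
           (\<lambda>a. z2_homology p (nerve_real (IU a) (U a)))
           (\<lambda>a a'. z2_induced p (nerve_real (IU a) (U a)) (nerve_real (IU a') (U a'))
                              (lin_ext (IU a) (FU a a')))
           (\<lambda>a. z2_homology p (nerve_real (IV a) (V a)))
           (\<lambda>a a'. z2_induced p (nerve_real (IV a) (V a)) (nerve_real (IV a') (V a'))
                              (lin_ext (IV a) (FV a a')))"
proof -
  let ?CU = "\<lambda>a. cover_space (IU a) (U a)" and ?CV = "\<lambda>a. cover_space (IV a) (V a)"
    and ?CW = "\<lambda>a. cover_space (IW a) (W a)"
  let ?H = "\<lambda>S. carrier (z2_homology p (top_of_set S))"
  let ?inc = "inc_induced p"
  have cov: "is_cover (IU a) (U a)" "is_cover (IV a) (V a)" "is_cover (IW a) (W a)" if "0 \<le> a" for a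
    using seqU seqV seqW that by (simp_all add: cover_sequenceD)
  have fin: "finite (IU a)" "finite (IV a)" "finite (IW a)" if "0 \<le> a" for a
    using cov[OF that] by (auto simp: is_cover_def)
  have FU: "map_of_covers (IU a) (U a) (IU a') (U a') (FU a a')"
    and FV: "map_of_covers (IV a) (V a) (IV a') (V a') (FV a a')"
    and FW: "map_of_covers (IW a) (W a) (IW a') (W a') (FW a a')" if "0 \<le> a" "a \<le> a'" for a a'
    using seqU seqV seqW that by (simp_all add: cover_sequenceD)
  note subU = cover_space_mono[OF FU] and subV = cover_space_mono[OF FV]
    and subW = cover_space_mono[OF FW]
  \<comment> \<open>\<open>c * (a / c) = a\<close> is what makes \<open>\<phi> (a / c)\<close> and
    \<open>\<psi> (a / c)\<close> land at index \<open>a\<close>.\<close>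
  have ge: "a \<le> c * a" "0 \<le> c * a" "0 \<le> a / c" "a / c \<le> a" "c * (a / c) = a" if "0 \<le> a" for a
    using c that mult_right_mono[of 1 c a] by (auto simp: field_simps)
  have UVc: "?CU a \<subseteq> ?CV (c * a)" if "0 \<le> a" for a
    using UV[OF that] subV[OF that ge(1)[OF that]] by blast

  \<comment> \<open>\<open>r\<close> and \<open>w\<close> carry nerve classes to classes of the
    spaces U(\<alpha>) and W(\<alpha>), which isolates the only two places where rho is
    inverted.\<close>
  define r where "r = (\<lambda>a. rho_inv p (IU a) (U a))"
  define w where "w = (\<lambda>a y. rho_inv p (IW a) (W a)
    (nerve_induced p (IV a) (V a) (IW a) (W a) (FVW a a) y))"
  have phi: "\<phi> a x = rho p (IV (c * a)) (V (c * a)) (?inc (?CU a) (?CV (c * a)) (r a x))" for a x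
    by (simp add: phi_def r_def)
  have psi: "\<psi> a y = rho p (IU (c * a)) (U (c * a)) (?inc (?CW a) (?CU (c * a)) (w a y))" for a y
    by (simp add: psi_def w_def)
  have r: "r a x \<in> ?H (?CU a)" "rho p (IU a) (U a) (r a x) = x"
    if "0 \<le> a" "x \<in> carrier (nerve_homology p (IU a) (U a))" for a x
    using that goodU cov by (auto simp: r_def rho_inv_in_carrier rho_rho_inv)
  have vw: "nerve_induced p (IV a) (V a) (IW a) (W a) (FVW a a) y \<in> carrier (nerve_homology p (IW a) (W a))"
    if "0 \<le> a" "y \<in> carrier (nerve_homology p (IV a) (V a))" for a y
    by (rule z2_induced_in_carrier[OF continuous_map_lin_ext]) (use that fin mapVW in auto)
  have w: "w a y \<in> ?H (?CW a)"
    "rho p (IW a) (W a) (w a y) = nerve_induced p (IV a) (V a) (IW a) (W a) (FVW a a) y"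
    if "0 \<le> a" "y \<in> carrier (nerve_homology p (IV a) (V a))" for a y
    using vw[OF that] that(1) goodW cov by (auto simp: w_def rho_inv_in_carrier rho_rho_inv)

  have phi_hom: "\<phi> a \<in> hom (nerve_homology p (IU a) (U a)) (nerve_homology p (IV (c * a)) (V (c * a)))"
    if a: "0 \<le> a" for a
    unfolding phi_def
    by (rule hom_compose[OF rho_inv_hom[OF cov(1)[OF a] goodU[OF a]]
          hom_compose[OF inc_induced_hom[OF UVc[OF a]] rho_hom[OF cov(2)[OF ge(2)[OF a]]]]])
  have psi_hom: "\<psi> a \<in> hom (nerve_homology p (IV a) (V a)) (nerve_homology p (IU (c * a)) (U (c * a)))"
    if a: "0 \<le> a" for a
    unfolding psi_def
    by (rule hom_compose[OF z2_induced_hom[OF continuous_map_lin_ext[OF fin(2,3)[OF a] mapVW[OF a order_refl]]]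
          hom_compose[OF rho_inv_hom[OF cov(3)[OF a] goodW[OF a]]
          hom_compose[OF inc_induced_hom[OF WU[OF a]] rho_hom[OF cov(1)[OF ge(2)[OF a]]]]]])

  \<comment> \<open>If a nerve class comes from a class of a subspace \<open>S\<close>, a transition
    map merely enlarges the target of the inclusion of \<open>S\<close>. Naturality then has to be
    invoked only once per sequence.\<close>
  have incU: "nerve_induced p (IU a) (U a) (IU a') (U a') (FU a a') (rho p (IU a) (U a) (?inc S (?CU a) x))
      = rho p (IU a') (U a') (?inc S (?CU a') x)"
    if "0 \<le> a" "a \<le> a'" "S \<subseteq> ?CU a" "x \<in> ?H S" for a a' S x
    using that rho_natural[OF cov(1) cov(1) FU, of a a' "?inc S (?CU a) x" p] subU[of a a']
    by (simp add: inc_induced_in_carrier inc_induced_compose)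
  have incV: "nerve_induced p (IV a) (V a) (IV a') (V a') (FV a a') (rho p (IV a) (V a) (?inc S (?CV a) x))
      = rho p (IV a') (V a') (?inc S (?CV a') x)"
    if "0 \<le> a" "a \<le> a'" "S \<subseteq> ?CV a" "x \<in> ?H S" for a a' S x
    using that rho_natural[OF cov(2) cov(2) FV, of a a' "?inc S (?CV a) x" p] subV[of a a']
    by (simp add: inc_induced_in_carrier inc_induced_compose)

  have rel1: "\<psi> a' (nerve_induced p (IV a) (V a) (IV a') (V a') (FV a a') (\<phi> (a / c) x)) =
      nerve_induced p (IU (a / c)) (U (a / c)) (IU (c * a')) (U (c * a')) (FU (a / c) (c * a')) x"
    if a: "0 \<le> a" "a \<le> a'" and x: "x \<in> carrier (nerve_homology p (IU (a / c)) (U (a / c)))" for a a' x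
  proof -
    have a': "0 \<le> a'" "a / c \<le> c * a'" using a ge(1)[of a'] ge(4)[of a] by linarith+
    note b = ge(3)[OF a(1)]
    let ?S = "?CU (a / c)" and ?x = "r (a / c) x"
    have S: "?S \<subseteq> ?CV a" "?S \<subseteq> ?CV a'" "?S \<subseteq> ?CW a'" "?S \<subseteq> ?CU (c * a')"
      using UVc[OF b] subV[OF a] VW[OF a'(1)] subU[OF b a'(2)] ge(5)[OF a(1)] by auto
    have eq: "nerve_induced p (IV a) (V a) (IV a') (V a') (FV a a') (\<phi> (a / c) x) =
        rho p (IV a') (V a') (?inc ?S (?CV a') ?x)"
      unfolding phi ge(5)[OF a(1)] by (rule incV[OF a S(1) r(1)[OF b x]])
    \<comment> \<open>Naturality along the map of covers from V to W rewrites the class as a value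
      of rho for the good cover W, where \<open>rho_inv\<close> cancels it.\<close>
    have "w a' (nerve_induced p (IV a) (V a) (IV a') (V a') (FV a a') (\<phi> (a / c) x)) =
        ?inc ?S (?CW a') ?x"
    proof -
      have "nerve_induced p (IV a') (V a') (IW a') (W a') (FVW a' a')
          (rho p (IV a') (V a') (?inc ?S (?CV a') ?x)) = rho p (IW a') (W a') (?inc ?S (?CW a') ?x)"
        using rho_natural[OF cov(2,3)[OF a'(1)] mapVW[OF a'(1) order_refl]] S VW[OF a'(1)] r(1)[OF b x]
        by (metis inc_induced_compose inc_induced_in_carrier)
      then show ?thesis
        unfolding w_def eq using rho_inv_rho[OF cov(3) goodW, OF a'(1) a'(1)] S(3) r(1)[OF b x]
        by (simp add: inc_induced_in_carrier)
    qed
    then have "\<psi> a' (nerve_induced p (IV a) (V a) (IV a') (V a') (FV a a') (\<phi> (a / c) x)) =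
        rho p (IU (c * a')) (U (c * a')) (?inc ?S (?CU (c * a')) ?x)"
      unfolding psi using inc_induced_compose[OF S(3) WU[OF a'(1)] r(1)[OF b x]] by simp
    also have "\<dots> = nerve_induced p (IU (a / c)) (U (a / c)) (IU (c * a')) (U (c * a')) (FU (a / c) (c * a')) x"
      using rho_natural[OF cov(1)[OF b] cov(1) FU[OF b a'(2)] r(1)[OF b x]] r(2)[OF b x] ge(2)[OF a'(1)]
      by simp
    finally show ?thesis .
  qed
  \<comment> \<open>Here \<open>y\<close> itself need not come from the space V; only its image in
    the nerve of W does. The route back to the nerve of V therefore uses the map of covers from W to
    V.\<close>
  have rel2: "\<phi> a' (nerve_induced p (IU a) (U a) (IU a') (U a') (FU a a') (\<psi> (a / c) y)) =
      nerve_induced p (IV (a / c)) (V (a / c)) (IV (c * a')) (V (c * a')) (FV (a / c) (c * a')) y"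
    if a: "0 \<le> a" "a \<le> a'" and y: "y \<in> carrier (nerve_homology p (IV (a / c)) (V (a / c)))" for a a' y
  proof -
    have a': "0 \<le> a'" "a / c \<le> a'" using a ge(4)[of a] by linarith+
    note b = ge(3)[OF a(1)]
    let ?S = "?CW (a / c)" and ?w = "w (a / c) y"
    have w': "?w \<in> ?H ?S" by (rule w(1)[OF b y])
    have S: "?S \<subseteq> ?CU a" "?S \<subseteq> ?CU a'"
      using WU[OF b] subU[OF a] ge(5)[OF a(1)] by auto
    have eq: "nerve_induced p (IU a) (U a) (IU a') (U a') (FU a a') (\<psi> (a / c) y) =
        rho p (IU a') (U a') (?inc ?S (?CU a') ?w)"
      unfolding psi ge(5)[OF a(1)] by (rule incU[OF a S(1) w'])
    have "r a' (nerve_induced p (IU a) (U a) (IU a') (U a') (FU a a') (\<psi> (a / c) y)) = ?inc ?S (?CU a') ?w"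
      unfolding r_def eq by (rule rho_inv_rho[OF cov(1) goodU, OF a'(1) a'(1) inc_induced_in_carrier[OF S(2) w']])
    then have "\<phi> a' (nerve_induced p (IU a) (U a) (IU a') (U a') (FU a a') (\<psi> (a / c) y)) =
        rho p (IV (c * a')) (V (c * a')) (?inc ?S (?CV (c * a')) ?w)"
      unfolding phi using inc_induced_compose[OF S(2) UVc[OF a'(1)] w'] by simp
    \<comment> \<open>The second index of \<open>FWV\<close> is not scaled:
      \<open>FWV (a / c) a'\<close> has target V at \<open>c * a'\<close>. The composite with
      \<open>FVW\<close> is then a transition map of V by \<open>coh2\<close>.\<close>
    also have "\<dots> = nerve_induced p (IW (a / c)) (W (a / c)) (IV (c * a')) (V (c * a')) (FWV (a / c) a')
        (nerve_induced p (IV (a / c)) (V (a / c)) (IW (a / c)) (W (a / c)) (FVW (a / c) (a / c)) y)"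
      using rho_natural[OF cov(3)[OF b] cov(2)[OF ge(2)[OF a'(1)]] mapWV[OF b a'(2)] w'] w(2)[OF b y]
      by simp
    also have "\<dots> = nerve_induced p (IV (a / c)) (V (a / c)) (IV (c * a')) (V (c * a')) (FV (a / c) (c * a')) y"
      by (rule nerve_induced_compose[OF fin(2)[OF b] fin(3)[OF b] fin(2)[OF ge(2)[OF a'(1)]]
          mapVW[OF b order_refl] mapWV[OF b a'(2)] coh2[OF a] y])
    finally show ?thesis .
  qed
  have rel3: "\<psi> a' (nerve_induced p (IV a) (V a) (IV a') (V a') (FV a a') y) =
      nerve_induced p (IU (c * a)) (U (c * a)) (IU (c * a')) (U (c * a')) (FU (c * a) (c * a')) (\<psi> a y)"
    if a: "0 \<le> a" "a \<le> a'" and y: "y \<in> carrier (nerve_homology p (IV a) (V a))" for a a' y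
  proof -
    have a': "0 \<le> a'" "c * a \<le> c * a'" using a c by (auto intro: mult_left_mono)
    note ca = ge(2)[OF a(1)] and ca' = ge(2)[OF a'(1)]
    have w': "w a y \<in> ?H (?CW a)" by (rule w(1)[OF a(1) y])
    \<comment> \<open>Both sides equal \<open>FVW a a'\<close>. This takes two degenerate instances
      of \<open>coh1\<close>, one with the first two indices equal and one with the last two equal,
      in which a transition map is the identity.\<close>
    have coh: "FVW a' a' (FV a a' j) = FW a a' (FVW a a j)" if j: "j \<in> IV a" for j
    proof -
      have "FVW a a' j \<in> IW a'" using mapVW[OF a] j by (auto simp: map_of_covers_def)
      then have "FW a' a' (FVW a a' j) = FVW a a' j"
        using cover_sequenceD(3)[OF seqW a'(1)] by simp
      moreover have "FV a a j = j" using cover_sequenceD(3)[OF seqV a(1) j] .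
      ultimately show ?thesis
        using coh1[OF a(1) order_refl a(2) j] coh1[OF a order_refl j] by simp
    qed
    have "nerve_induced p (IV a') (V a') (IW a') (W a') (FVW a' a')
        (nerve_induced p (IV a) (V a) (IV a') (V a') (FV a a') y) =
        nerve_induced p (IV a) (V a) (IW a') (W a') (\<lambda>j. FW a a' (FVW a a j)) y"
      by (rule nerve_induced_compose[OF fin(2)[OF a(1)] fin(2)[OF a'(1)] fin(3)[OF a'(1)]
          FV[OF a] mapVW[OF a'(1) order_refl] coh y])
    also have "\<dots> = nerve_induced p (IW a) (W a) (IW a') (W a') (FW a a')
        (nerve_induced p (IV a) (V a) (IW a) (W a) (FVW a a) y)"
      by (rule nerve_induced_compose[OF fin(2)[OF a(1)] fin(3)[OF a(1)] fin(3)[OF a'(1)]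
          mapVW[OF a(1) order_refl] FW[OF a] refl y, symmetric])
    finally have "w a' (nerve_induced p (IV a) (V a) (IV a') (V a') (FV a a') y) =
        ?inc (?CW a) (?CW a') (w a y)"
      unfolding w_def
      using rho_inv_natural[OF cov(3) goodW cov(3) goodW FW[OF a] vw[OF a(1) y], OF a(1) a(1) a'(1) a'(1)]
      by simp
    then have "\<psi> a' (nerve_induced p (IV a) (V a) (IV a') (V a') (FV a a') y) =
        rho p (IU (c * a')) (U (c * a')) (?inc (?CW a) (?CU (c * a')) (w a y))"
      unfolding psi using inc_induced_compose[OF subW[OF a] WU[OF a'(1)] w'] by simp
    then show ?thesis
      unfolding psi[of a] using incU[OF ca a'(2) WU[OF a(1)] w'] by simp
  qed
  have rel4: "\<phi> a' (nerve_induced p (IU a) (U a) (IU a') (U a') (FU a a') x) =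
      nerve_induced p (IV (c * a)) (V (c * a)) (IV (c * a')) (V (c * a')) (FV (c * a) (c * a')) (\<phi> a x)"
    if a: "0 \<le> a" "a \<le> a'" and x: "x \<in> carrier (nerve_homology p (IU a) (U a))" for a a' x
  proof -
    have a': "0 \<le> a'" "c * a \<le> c * a'" using a c by (auto intro: mult_left_mono)
    have x': "r a x \<in> ?H (?CU a)" by (rule r(1)[OF a(1) x])
    \<comment> \<open>Goodness of U at both indices turns the transition map of nerves into an
      inclusion of spaces; inclusions then compose in either order.\<close>
    have "r a' (nerve_induced p (IU a) (U a) (IU a') (U a') (FU a a') x) = ?inc (?CU a) (?CU a') (r a x)"
      unfolding r_def
      by (rule rho_inv_natural[OF cov(1) goodU cov(1) goodU FU[OF a] x, OF a(1) a(1) a'(1) a'(1)])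
    then have "\<phi> a' (nerve_induced p (IU a) (U a) (IU a') (U a') (FU a a') x) =
        rho p (IV (c * a')) (V (c * a')) (?inc (?CU a) (?CV (c * a')) (r a x))"
      unfolding phi using inc_induced_compose[OF subU[OF a] UVc[OF a'(1)] x'] by simp
    then show ?thesis
      unfolding phi[of a] using incV[OF ge(2)[OF a(1)] a'(2) UVc[OF a(1)] x'] by simp
  qed
  have "c_approximate_via c
           (\<lambda>a. z2_homology p (nerve_real (IU a) (U a)))
           (\<lambda>a a'. z2_induced p (nerve_real (IU a) (U a)) (nerve_real (IU a') (U a'))
                              (lin_ext (IU a) (FU a a')))
           (\<lambda>a. z2_homology p (nerve_real (IV a) (V a)))
           (\<lambda>a a'. z2_induced p (nerve_real (IV a) (V a)) (nerve_real (IV a') (V a'))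
                              (lin_ext (IV a) (FV a a')))
           \<phi> \<psi>"
    unfolding c_approximate_via_def
    by (intro conjI allI impI ballI; (elim conjE)?; rule phi_hom psi_hom rel1 rel2 rel3 rel4; assumption)
  then show ?thesis unfolding c_approximate_def by blast
qed

end
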